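(* Let $R$ be a commutative ring and let $a,b\in\mathbb{Z}_{>0}$. In $\Lambda_R$, the products $$s_\lambda s_{\lambda^\vee},\qquad \lambda\subseteq (b^a),$$ indexed by unordered complementary pairs $\{\lambda,\lambda^\vee\}$ (one product for each such unordered pair), are linearly independent over $R$.
   Context: $\Lambda_{\mathbb{Z}}$ is the ring of symmetric functions over $\mathbb{Z}$ in infinitely many variables, and $\Lambda_R=R\otimes_{\mathbb{Z}}\Lambda_{\mathbb{Z}}$. $s_\lambda$ denotes the Schur function of the partition $\lambda$. $(b^a)$ denotes the $a\times b$ rectangle, i.e. the partition with $a$ parts equal to $b$; partitions are padded with trailing zeros when needed, and $\lambda\subseteq\mu$ means $\lambda_i\le\mu_i$ for all $i$. For $\lambda=(\lambda_1,\ldots,\lambda_a)\subseteq(b^a)$, the rectangular complement is $\lambda^\vee=(b-\lambda_a,\ldots,b-\lambda_1)$ (trailing zeros deleted when regarded as a partition). The map $\lambda\mapsto\lambda^\vee$ is an involution on the partitions contained in $(b^a)$; its orbits $\{\lambda,\lambda^\vee\}$ (possibly with $\lambda=\lambda^\vee$) are the unordered complementary pairs. *)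

theory Defs
  imports "HOL-Library.Poly_Mapping" "HOL-Library.Multiset" "HOL-Library.FuncSet"
    "HOL-Combinatorics.Permutations"
begin

section \<open>The ring of symmetric functions over the integers\<close>

text \<open>
  The variables are \<open>x\<^sub>0, x\<^sub>1, x\<^sub>2, \<dots>\<close>.  A monomial is the multiset of the indices of its
  variables, so the product of monomials is the sum of multisets and the degree is the size.
  A symmetric function is a formal power series of bounded degree, given by its coefficients,
  that is invariant under all finitary permutations of the variables.
\<close>

definition symmetric_series :: "(nat multiset \<Rightarrow> int) \<Rightarrow> bool" where
  "symmetric_series f \<longleftrightarrow> (\<forall>p m. permutation p \<longrightarrow> f (image_mset p m) = f m)"

definition bounded_degree :: "(nat multiset \<Rightarrow> int) \<Rightarrow> bool" where
  "bounded_degree f \<longleftrightarrow> (\<exists>d. \<forall>m. f m \<noteq> 0 \<longrightarrow> size m \<le> d)"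

definition series_mult ::
    "(nat multiset \<Rightarrow> int) \<Rightarrow> (nat multiset \<Rightarrow> int) \<Rightarrow> nat multiset \<Rightarrow> int" where
  "series_mult f g m = (\<Sum>(k, l) \<in> {(k, l). k + l = m}. f k * g l)"

lemma finite_mset_sums: "finite {(k, l :: 'a multiset). k + l = m}"
proof (induction m)
  case empty
  have "{(k, l :: 'a multiset). k + l = {#}} = {({#}, {#})}" by auto
  then show ?case by simp
next
  case (add x m)
  let ?S = "{(k, l :: 'a multiset). k + l = m}"
  have "{(k, l). k + l = add_mset x m}
      \<subseteq> (\<lambda>(k, l). (add_mset x k, l)) ` ?S \<union> (\<lambda>(k, l). (k, add_mset x l)) ` ?S"
  proof safe
    fix k l
    assume kl: "k + l = add_mset x m"
      and no: "(k, l) \<notin> (\<lambda>(k, l). (k, add_mset x l)) ` ?S"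
    have "x \<in># k"
    proof (rule ccontr)
      assume "x \<notin># k"
      then have "x \<in># l" using kl by (metis union_iff union_single_eq_member)
      then obtain l' where l': "l = add_mset x l'" by (metis insert_DiffM)
      with kl have "k + l' = m" by simp
      with no l' show False by (auto simp: image_iff)
    qed
    then obtain k' where k': "k = add_mset x k'" by (metis insert_DiffM)
    with kl have "k' + l = m" by simp
    with k' show "(k, l) \<in> (\<lambda>(k, l). (add_mset x k, l)) ` ?S" by (auto simp: image_iff)
  qed
  moreover have "finite ((\<lambda>(k, l). (add_mset x k, l)) ` ?S \<union> (\<lambda>(k, l). (k, add_mset x l)) ` ?S)"
    using add.IH by simp
  ultimately show ?case by (rule finite_subset)
qed

lemma series_mult_assoc: "series_mult (series_mult f g) h = series_mult f (series_mult g h)"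
proof
  fix m
  have "series_mult (series_mult f g) h m
      = (\<Sum>p \<in> {(k, l). k + l = m}. \<Sum>q \<in> {(u, v). u + v = fst p}. f (fst q) * g (snd q) * h (snd p))"
    by (simp add: series_mult_def case_prod_beta sum_distrib_right)
  also have "\<dots> = (\<Sum>z \<in> (SIGMA p:{(k, l). k + l = m}. {(u, v). u + v = fst p}).
      f (fst (snd z)) * g (snd (snd z)) * h (snd (fst z)))"
    by (subst sum.Sigma) (auto simp: finite_mset_sums case_prod_beta)
  also have "\<dots> = (\<Sum>z \<in> (SIGMA p:{(k, l). k + l = m}. {(u, v). u + v = snd p}).
      f (fst (fst z)) * (g (fst (snd z)) * h (snd (snd z))))"
    by (rule sum.reindex_bij_witness[where
          i = "\<lambda>((k, l), (u, v)). ((k + u, v), (k, u))" and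
          j = "\<lambda>((k, l), (u, v)). ((u, v + l), (v, l))"])
      (auto simp: ac_simps)
  also have "\<dots> = (\<Sum>p \<in> {(k, l). k + l = m}. \<Sum>q \<in> {(u, v). u + v = snd p}.
      f (fst p) * (g (fst q) * h (snd q)))"
    by (subst sum.Sigma) (auto simp: finite_mset_sums case_prod_beta)
  also have "\<dots> = series_mult f (series_mult g h) m"
    by (simp add: series_mult_def case_prod_beta sum_distrib_left)
  finally show "series_mult (series_mult f g) h m = series_mult f (series_mult g h) m" .
qed

lemma series_mult_commute: "series_mult f g = series_mult g f"
proof
  fix m
  show "series_mult f g m = series_mult g f m"
    unfolding series_mult_def
    by (rule sum.reindex_bij_witness[where i = prod.swap and j = prod.swap])
      (auto simp: ac_simps)
qed

lemma series_mult_one: "series_mult (\<lambda>m. if m = {#} then 1 else 0) f = f"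
proof
  fix m
  have "series_mult (\<lambda>m. if m = {#} then 1 else 0) f m
      = (\<Sum>p \<in> {({#} :: nat multiset, m)}. (if fst p = {#} then 1 else 0) * f (snd p))"
    unfolding series_mult_def
    by (rule sum.mono_neutral_cong_right) (auto simp: finite_mset_sums split: if_splits)
  then show "series_mult (\<lambda>m. if m = {#} then 1 else 0) f m = f m" by simp
qed

lemma series_mult_add: "series_mult (\<lambda>m. f m + g m) h = (\<lambda>m. series_mult f h m + series_mult g h m)"
  by (simp add: series_mult_def fun_eq_iff case_prod_beta algebra_simps sum.distrib)

lemma symmetric_series_mult:
  assumes "symmetric_series f" "symmetric_series g"
  shows "symmetric_series (series_mult f g)"
  unfolding symmetric_series_def
proof (intro allI impI)
  fix p :: "nat \<Rightarrow> nat" and m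
  assume p: "permutation p"
  let ?q = "inv p"
  have q: "permutation ?q" using p by (rule permutation_inverse)
  have pq: "p \<circ> ?q = id" "?q \<circ> p = id"
    using permutation_bijective[OF p] by (simp_all add: bij_is_inj bij_is_surj flip: inj_iff surj_iff)
  have pq': "image_mset p (image_mset ?q k) = k" "image_mset ?q (image_mset p k) = k" for k
    using pq by (simp_all add: multiset.map_comp)
  show "series_mult f g (image_mset p m) = series_mult f g m"
    unfolding series_mult_def
  proof (rule sum.reindex_bij_witness[where
        i = "\<lambda>(k, l). (image_mset p k, image_mset p l)" and
        j = "\<lambda>(k, l). (image_mset ?q k, image_mset ?q l)"])
  qed (use assms q pq' in \<open>auto simp: symmetric_series_def simp flip: image_mset_union\<close>)
qed

lemma bounded_degree_mult:
  assumes "bounded_degree f" "bounded_degree g"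
  shows "bounded_degree (series_mult f g)"
proof -
  obtain d e where d: "\<And>m. f m \<noteq> 0 \<Longrightarrow> size m \<le> d" and e: "\<And>m. g m \<noteq> 0 \<Longrightarrow> size m \<le> e"
    using assms unfolding bounded_degree_def by blast
  have "size m \<le> d + e" if "series_mult f g m \<noteq> 0" for m
  proof -
    obtain k l where "k + l = m" "f k * g l \<noteq> 0"
      using \<open>series_mult f g m \<noteq> 0\<close> unfolding series_mult_def
      by (smt (verit) case_prodE mem_Collect_eq sum.neutral case_prod_conv)
    then show ?thesis using d[of k] e[of l] by auto
  qed
  then show ?thesis unfolding bounded_degree_def by blast
qed

typedef symfun = "{f. symmetric_series f \<and> bounded_degree f}"
  morphisms symfun_coeff Abs_symfun
  by (rule exI[of _ "\<lambda>_. 0"]) (simp add: symmetric_series_def bounded_degree_def)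

setup_lifting type_definition_symfun

instantiation symfun :: comm_ring_1
begin

lift_definition zero_symfun :: symfun is "\<lambda>_. 0"
  by (simp add: symmetric_series_def bounded_degree_def)

lift_definition one_symfun :: symfun is "\<lambda>m. if m = {#} then 1 else 0"
  by (auto simp: symmetric_series_def bounded_degree_def)

lift_definition plus_symfun :: "symfun \<Rightarrow> symfun \<Rightarrow> symfun" is "\<lambda>f g m. f m + g m"
proof
  fix f g :: "nat multiset \<Rightarrow> int"
  assume f: "symmetric_series f \<and> bounded_degree f" and g: "symmetric_series g \<and> bounded_degree g"
  then show "symmetric_series (\<lambda>m. f m + g m)" by (simp add: symmetric_series_def)
  from f g obtain d e where d: "\<And>m. f m \<noteq> 0 \<Longrightarrow> size m \<le> d" and e: "\<And>m. g m \<noteq> 0 \<Longrightarrow> size m \<le> e"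
    unfolding bounded_degree_def by blast
  have "size m \<le> max d e" if "f m + g m \<noteq> 0" for m
    using d[of m] e[of m] that by fastforce
  then show "bounded_degree (\<lambda>m. f m + g m)" unfolding bounded_degree_def by blast
qed

lift_definition uminus_symfun :: "symfun \<Rightarrow> symfun" is "\<lambda>f m. - f m"
  by (simp add: symmetric_series_def bounded_degree_def)

definition minus_symfun :: "symfun \<Rightarrow> symfun \<Rightarrow> symfun" where
  "minus_symfun f g = f + - g"

lift_definition times_symfun :: "symfun \<Rightarrow> symfun \<Rightarrow> symfun" is series_mult
  by (simp add: symmetric_series_mult bounded_degree_mult)

instance
proof
  fix f g h :: symfun
  show "f + g + h = f + (g + h)" by transfer (simp add: fun_eq_iff)
  show "f + g = g + f" by transfer (simp add: fun_eq_iff)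
  show "0 + f = f" by transfer simp
  show "- f + f = 0" by transfer simp
  show "f - g = f + - g" by (rule minus_symfun_def)
  show "f * g * h = f * (g * h)" by transfer (rule series_mult_assoc)
  show "f * g = g * f" by transfer (rule series_mult_commute)
  show "1 * f = f" by transfer (rule series_mult_one)
  show "(f + g) * h = f * h + g * h" by transfer (rule series_mult_add)
  show "(0::symfun) \<noteq> 1" by transfer (auto simp: fun_eq_iff)
qed

end


section \<open>Tensor products of commutative rings over the integers\<close>

text \<open>
  \<open>A \<otimes>\<^sub>\<int> B\<close> is the quotient of the free abelian group on \<open>A \<times> B\<close> by the subgroup generated by the
  biadditivity relations; the balancing relation \<open>(n a) \<otimes> b = a \<otimes> (n b)\<close> for integers \<open>n\<close> follows
  from them.  The sort \<open>{comm_ring, comm_monoid_mult}\<close> is that of commutative rings with \<open>1\<close>; in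
  contrast to \<open>comm_ring_1\<close> it does not demand \<open>0 \<noteq> 1\<close>.
\<close>

inductive tensor_null :: "('a::ab_group_add \<times> 'b::ab_group_add \<Rightarrow>\<^sub>0 int) \<Rightarrow> bool" where
  left: "tensor_null (frag_of (a + a', b) - frag_of (a, b) - frag_of (a', b))"
| right: "tensor_null (frag_of (a, b + b') - frag_of (a, b) - frag_of (a, b'))"
| zero: "tensor_null 0"
| diff: "tensor_null x \<Longrightarrow> tensor_null y \<Longrightarrow> tensor_null (x - y)"

lemma tensor_null_uminus: "tensor_null x \<Longrightarrow> tensor_null (- x)"
  using tensor_null.diff[OF tensor_null.zero] by fastforce

lemma tensor_null_add: "tensor_null x \<Longrightarrow> tensor_null y \<Longrightarrow> tensor_null (x + y)"
  using tensor_null.diff[OF _ tensor_null_uminus] by fastforce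

definition tensor_rel ::
    "('a::ab_group_add \<times> 'b::ab_group_add \<Rightarrow>\<^sub>0 int) \<Rightarrow> ('a \<times> 'b \<Rightarrow>\<^sub>0 int) \<Rightarrow> bool" where
  "tensor_rel x y \<longleftrightarrow> tensor_null (x - y)"

quotient_type (overloaded) ('a, 'b) tensor = "'a::ab_group_add \<times> 'b::ab_group_add \<Rightarrow>\<^sub>0 int" / tensor_rel
proof (rule equivpI)
  show "reflp (tensor_rel :: ('a \<times> 'b \<Rightarrow>\<^sub>0 int) \<Rightarrow> _)"
    by (simp add: reflp_def tensor_rel_def tensor_null.zero)
  show "symp (tensor_rel :: ('a \<times> 'b \<Rightarrow>\<^sub>0 int) \<Rightarrow> _)"
    unfolding symp_def tensor_rel_def using tensor_null_uminus by fastforce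
  show "transp (tensor_rel :: ('a \<times> 'b \<Rightarrow>\<^sub>0 int) \<Rightarrow> _)"
    unfolding transp_def tensor_rel_def using tensor_null_add by fastforce
qed

lift_definition pure_tensor :: "'a::ab_group_add \<Rightarrow> 'b::ab_group_add \<Rightarrow> ('a, 'b) tensor"
    (infixl "\<otimes>\<^sub>\<int>" 75)
  is "\<lambda>a b. frag_of (a, b)" .

definition frag_mult ::
    "('a::times \<times> 'b::times \<Rightarrow>\<^sub>0 int) \<Rightarrow> ('a \<times> 'b \<Rightarrow>\<^sub>0 int) \<Rightarrow> ('a \<times> 'b \<Rightarrow>\<^sub>0 int)" where
  "frag_mult x y =
     frag_extend (\<lambda>p. frag_extend (\<lambda>q. frag_of (fst p * fst q, snd p * snd q)) y) x"

lemma frag_mult_of [simp]: "frag_mult (frag_of (a, b)) (frag_of (c, d)) = frag_of (a * c, b * d)"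
  by (simp add: frag_mult_def)

lemma frag_mult_zero_left [simp]: "frag_mult 0 y = 0"
  by (simp add: frag_mult_def)

lemma frag_mult_diff_left: "frag_mult (x - x') y = frag_mult x y - frag_mult x' y"
  by (simp add: frag_mult_def frag_extend_diff)

lemma frag_mult_zero_right [simp]: "frag_mult x 0 = 0"
  by (simp add: frag_mult_def frag_extend_def)

lemma frag_mult_diff_right: "frag_mult x (y - y') = frag_mult x y - frag_mult x y'"
  by (induction x rule: frag_induction[OF subset_UNIV])
    (simp_all add: frag_mult_diff_left algebra_simps, simp add: frag_mult_def frag_extend_diff)

lemma frag_mult_add_left: "frag_mult (x + x') y = frag_mult x y + frag_mult x' y"
  by (simp add: frag_mult_def frag_extend_add)

lemma frag_pair_induct [case_names zero of diff]:
  fixes x :: "'a \<times> 'b \<Rightarrow>\<^sub>0 int"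
  assumes "P 0" "\<And>a b. P (frag_of (a, b))" "\<And>x y. P x \<Longrightarrow> P y \<Longrightarrow> P (x - y)"
  shows "P x"
  by (rule frag_induction[OF subset_UNIV]) (use assms in auto)

lemma frag_mult_commute:
  fixes x :: "'a::ab_semigroup_mult \<times> 'b::ab_semigroup_mult \<Rightarrow>\<^sub>0 int"
  shows "frag_mult x y = frag_mult y x"
proof (induction x rule: frag_pair_induct)
  case (of a b)
  show ?case
    by (induction y rule: frag_pair_induct)
      (simp_all add: frag_mult_diff_left frag_mult_diff_right mult.commute)
qed (simp_all add: frag_mult_diff_left frag_mult_diff_right)

lemma frag_mult_assoc:
  fixes x :: "'a::semigroup_mult \<times> 'b::semigroup_mult \<Rightarrow>\<^sub>0 int"
  shows "frag_mult (frag_mult x y) z = frag_mult x (frag_mult y z)"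
proof (induction x rule: frag_pair_induct)
  case (of a b)
  show ?case
  proof (induction y rule: frag_pair_induct)
    case (of c d)
    show ?case
      by (induction z rule: frag_pair_induct)
        (simp_all add: frag_mult_diff_left frag_mult_diff_right mult.assoc)
  qed (simp_all add: frag_mult_diff_left frag_mult_diff_right)
qed (simp_all add: frag_mult_diff_left frag_mult_diff_right)

lemma frag_mult_one:
  fixes x :: "'a::comm_monoid_mult \<times> 'b::comm_monoid_mult \<Rightarrow>\<^sub>0 int"
  shows "frag_mult (frag_of (1, 1)) x = x"
  by (induction x rule: frag_pair_induct) (simp_all add: frag_mult_diff_right)

lemma tensor_null_mult:
  fixes x y :: "'a::comm_ring \<times> 'b::comm_ring \<Rightarrow>\<^sub>0 int"
  assumes "tensor_null x"
  shows "tensor_null (frag_mult x y)"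
proof (induction y rule: frag_pair_induct)
  case zero
  show ?case by (simp add: tensor_null.zero)
next
  case (of c d)
  show ?case
    using assms
  proof induction
    case (left a a' b)
    show ?case by (simp add: frag_mult_diff_left distrib_right tensor_null.left)
  next
    case (right a b b')
    show ?case by (simp add: frag_mult_diff_left distrib_right tensor_null.right)
  qed (simp_all add: frag_mult_diff_left tensor_null.zero tensor_null.diff)
next
  case (diff y y')
  then show ?case by (simp add: frag_mult_diff_right tensor_null.diff)
qed

instantiation tensor ::
  ("{comm_ring, comm_monoid_mult}", "{comm_ring, comm_monoid_mult}") "{comm_ring, comm_monoid_mult}"
begin

lift_definition zero_tensor :: "('a, 'b) tensor" is 0 .

lift_definition one_tensor :: "('a, 'b) tensor" is "frag_of (1, 1)" .

lift_definition plus_tensor :: "('a, 'b) tensor \<Rightarrow> ('a, 'b) tensor \<Rightarrow> ('a, 'b) tensor" is "(+)"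
proof -
  fix x x' y y' :: "'a \<times> 'b \<Rightarrow>\<^sub>0 int"
  assume "tensor_rel x x'" "tensor_rel y y'"
  then have "tensor_null ((x - x') + (y - y'))"
    unfolding tensor_rel_def by (rule tensor_null_add)
  then show "tensor_rel (x + y) (x' + y')"
    by (simp add: tensor_rel_def algebra_simps)
qed

lift_definition uminus_tensor :: "('a, 'b) tensor \<Rightarrow> ('a, 'b) tensor" is uminus
  unfolding tensor_rel_def using tensor_null_uminus by fastforce

definition minus_tensor :: "('a, 'b) tensor \<Rightarrow> ('a, 'b) tensor \<Rightarrow> ('a, 'b) tensor" where
  "minus_tensor x y = x + - y"

lift_definition times_tensor :: "('a, 'b) tensor \<Rightarrow> ('a, 'b) tensor \<Rightarrow> ('a, 'b) tensor"
  is frag_mult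
proof -
  fix x x' y y' :: "'a \<times> 'b \<Rightarrow>\<^sub>0 int"
  assume "tensor_rel x x'" "tensor_rel y y'"
  then have "tensor_null (frag_mult (x - x') y)" "tensor_null (frag_mult (y - y') x')"
    unfolding tensor_rel_def by (simp_all add: tensor_null_mult)
  then have "tensor_null (frag_mult (x - x') y + frag_mult x' (y - y'))"
    using tensor_null_add frag_mult_commute by metis
  then show "tensor_rel (frag_mult x y) (frag_mult x' y')"
    by (simp add: tensor_rel_def frag_mult_diff_left frag_mult_diff_right)
qed

instance
proof
  fix x y z :: "('a, 'b) tensor"
  note refl = tensor_rel_def tensor_null.zero
  show "x + y + z = x + (y + z)" by transfer (simp add: refl add.assoc)
  show "x + y = y + x" by transfer (simp add: refl add.commute)
  show "0 + x = x" by transfer (simp add: refl)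
  show "- x + x = 0" by transfer (simp add: refl)
  show "x - y = x + - y" by (rule minus_tensor_def)
  show "x * y * z = x * (y * z)" by transfer (simp add: refl frag_mult_assoc)
  show "x * y = y * x" by transfer (simp add: refl frag_mult_commute[of _ y for y])
  show "1 * x = x" by transfer (simp add: refl frag_mult_one)
  show "(x + y) * z = x * z + y * z" by transfer (simp add: refl frag_mult_add_left)
qed

end

definition tensor_scale ::
    "'a::{comm_ring, comm_monoid_mult} \<Rightarrow> ('a, 'b::{comm_ring, comm_monoid_mult}) tensor
      \<Rightarrow> ('a, 'b) tensor" where
  "tensor_scale r x = (r \<otimes>\<^sub>\<int> 1) * x"

lemma pure_tensor_mult:
  fixes a c :: "'a::{comm_ring, comm_monoid_mult}" and b d :: "'b::{comm_ring, comm_monoid_mult}"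
  shows "(a \<otimes>\<^sub>\<int> b) * (c \<otimes>\<^sub>\<int> d) = (a * c) \<otimes>\<^sub>\<int> (b * d)"
  by transfer (simp add: tensor_rel_def tensor_null.zero)

lemma tensor_scale_pure: "tensor_scale r (a \<otimes>\<^sub>\<int> b) = (r * a) \<otimes>\<^sub>\<int> b"
  by (simp add: tensor_scale_def pure_tensor_mult)

lemma pure_tensor_add_left:
  fixes a a' :: "'a::{comm_ring, comm_monoid_mult}" and b :: "'b::{comm_ring, comm_monoid_mult}"
  shows "(a + a') \<otimes>\<^sub>\<int> b = a \<otimes>\<^sub>\<int> b + a' \<otimes>\<^sub>\<int> b"
  by transfer (simp add: tensor_rel_def tensor_null.left flip: diff_diff_eq)

lemma pure_tensor_add_right:
  fixes a :: "'a::{comm_ring, comm_monoid_mult}" and b b' :: "'b::{comm_ring, comm_monoid_mult}"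
  shows "a \<otimes>\<^sub>\<int> (b + b') = a \<otimes>\<^sub>\<int> b + a \<otimes>\<^sub>\<int> b'"
  by transfer (simp add: tensor_rel_def tensor_null.right flip: diff_diff_eq)

type_synonym 'r Lambda = "('r, symfun) tensor"


section \<open>Partitions and Schur functions\<close>

text \<open>
  A partition is a weakly decreasing sequence of naturals that is eventually zero, so padding with
  trailing zeros is built in.  Rows, columns and variables are numbered from \<open>0\<close>.
\<close>

typedef partition = "{l :: nat \<Rightarrow> nat. antimono l \<and> finite {i. l i \<noteq> 0}}"
  morphisms part Abs_partition
  by (rule exI[of _ "\<lambda>_. 0"]) (simp add: antimono_def)

setup_lifting type_definition_partition

definition part_le :: "partition \<Rightarrow> partition \<Rightarrow> bool" (infix "\<subseteq>\<^sub>p" 50) where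
  "l \<subseteq>\<^sub>p m \<longleftrightarrow> (\<forall>i. part l i \<le> part m i)"

text \<open>\<open>rectangle a b\<close> has \<open>a\<close> parts equal to \<open>b\<close>.\<close>

lift_definition rectangle :: "nat \<Rightarrow> nat \<Rightarrow> partition" is "\<lambda>a b i. if i < a then b else 0"
  by (auto simp: antimono_def)

text \<open>Only meaningful for \<open>l \<subseteq>\<^sub>p rectangle a b\<close>; otherwise the subtraction truncates.\<close>

lift_definition complement :: "nat \<Rightarrow> nat \<Rightarrow> partition \<Rightarrow> partition"
  is "\<lambda>a b l i. if i < a then b - l (a - 1 - i) else 0"
proof
  fix a b :: nat and l :: "nat \<Rightarrow> nat"
  assume "antimono l \<and> finite {i. l i \<noteq> 0}"
  then show "antimono (\<lambda>i. if i < a then b - l (a - 1 - i) else 0)"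
    by (auto simp: antimono_def intro!: diff_le_mono2)
qed auto

definition diagram :: "(nat \<Rightarrow> nat) \<Rightarrow> (nat \<times> nat) set" where
  "diagram l = {(i, j). j < l i}"

definition ssyt :: "(nat \<Rightarrow> nat) \<Rightarrow> (nat \<times> nat \<Rightarrow> nat) set" where
  "ssyt l = {T \<in> extensional (diagram l).
     (\<forall>i j. (i, Suc j) \<in> diagram l \<longrightarrow> T (i, j) \<le> T (i, Suc j)) \<and>
     (\<forall>i j. (Suc i, j) \<in> diagram l \<longrightarrow> T (i, j) < T (Suc i, j))}"

definition tableau_content :: "(nat \<Rightarrow> nat) \<Rightarrow> (nat \<times> nat \<Rightarrow> nat) \<Rightarrow> nat multiset" where
  "tableau_content l T = image_mset T (mset_set (diagram l))"

definition schur_series :: "(nat \<Rightarrow> nat) \<Rightarrow> nat multiset \<Rightarrow> int" where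
  "schur_series l m = int (card {T \<in> ssyt l. tableau_content l T = m})"

text \<open>
  Symmetry of the tableau generating function is shown by the toggle involution: in terms of the
  numbers of entries below \<open>k\<close> in each row, it reflects the middle one of the three shapes cut out by
  the entries below \<open>k\<close>, \<open>k + 1\<close> and \<open>k + 2\<close>.
\<close>

locale fixed_shape =
  fixes l :: "nat \<Rightarrow> nat"
  assumes antimono: "antimono l" and fin: "finite {i. l i \<noteq> 0}"
begin

definition "rows = Suc (Max (insert 0 {i. l i \<noteq> 0}))"

lemma rows: "r \<ge> rows \<Longrightarrow> l r = 0"
  using fin Max_ge[of "insert 0 {i. l i \<noteq> 0}" r] unfolding rows_def by fastforce

lemma diagram_eq: "diagram l = (SIGMA r:{..<rows}. {..<l r})"
  using rows by (auto simp: diagram_def) (metis leI less_nat_zero_code)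

lemma finite_diagram: "finite (diagram l)"
  by (simp add: diagram_eq)

lemma size_content: "size (tableau_content l T) = card (diagram l)"
  by (simp add: tableau_content_def)

definition below :: "(nat \<times> nat \<Rightarrow> nat) \<Rightarrow> nat \<Rightarrow> nat \<Rightarrow> nat" where
  "below T r k = card {j. j < l r \<and> T (r, j) < k}"

lemma belowI:
  assumes "n \<le> l r" and "\<And>j. j < l r \<Longrightarrow> T (r, j) < k \<longleftrightarrow> j < n"
  shows "below T r k = n"
proof -
  have "{j. j < l r \<and> T (r, j) < k} = {..<n}" using assms by auto
  then show ?thesis by (simp add: below_def)
qed

lemma row_mono:
  assumes "T \<in> ssyt l" "j \<le> j'" "j' < l r"
  shows "T (r, j) \<le> T (r, j')"
  using assms(2,3)
proof (induction j' rule: dec_induct)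
  case (step n)
  then have "T (r, n) \<le> T (r, Suc n)" using assms(1) by (auto simp: ssyt_def diagram_def)
  with step show ?case by simp
qed simp

lemma below_iff:
  assumes T: "T \<in> ssyt l" and j: "j < l r"
  shows "T (r, j) < k \<longleftrightarrow> j < below T r k"
proof -
  let ?S = "{j. j < l r \<and> T (r, j) < k}"
  have fin: "finite ?S" by simp
  show ?thesis
  proof
    assume "T (r, j) < k"
    then have "{..j} \<subseteq> ?S" using row_mono[OF T] j by fastforce
    then have "card {..j} \<le> card ?S" using fin by (rule card_mono[rotated])
    then show "j < below T r k" by (simp add: below_def)
  next
    assume lt: "j < below T r k"
    show "T (r, j) < k"
    proof (rule ccontr)
      assume no: "\<not> T (r, j) < k"
      have "?S \<subseteq> {..<j}"
      proof
        fix x assume x: "x \<in> ?S"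
        show "x \<in> {..<j}"
        proof (rule ccontr)
          assume "x \<notin> {..<j}"
          then have "T (r, j) \<le> T (r, x)" using row_mono[OF T, of j x r] x by auto
          with x no show False by auto
        qed
      qed
      then have "card ?S \<le> card {..<j}" by (rule card_mono[rotated]) simp
      with lt show False by (simp add: below_def)
    qed
  qed
qed

lemma below_le: "below T r k \<le> l r"
proof -
  have "card {j. j < l r \<and> T (r, j) < k} \<le> card {..<l r}" by (rule card_mono) auto
  then show ?thesis by (simp add: below_def)
qed

lemma below_mono: "k \<le> k' \<Longrightarrow> below T r k \<le> below T r k'"
  unfolding below_def by (rule card_mono) auto

lemma below_interlace:
  assumes T: "T \<in> ssyt l"
  shows "below T (Suc r) (Suc k) \<le> below T r k"
proof (rule ccontr)
  assume "\<not> below T (Suc r) (Suc k) \<le> below T r k"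
  then have lt: "below T r k < below T (Suc r) (Suc k)" by simp
  let ?j = "below T r k"
  have j: "?j < l (Suc r)" using lt below_le[of T "Suc r" "Suc k"] by linarith
  then have j': "?j < l r" using antimonoD[OF antimono, of r "Suc r"] by simp
  have "T (Suc r, ?j) < Suc k" using below_iff[OF T j] lt by blast
  moreover have "T (r, ?j) < T (Suc r, ?j)" using T j by (auto simp: ssyt_def diagram_def)
  ultimately have "T (r, ?j) < k" by linarith
  then show False using below_iff[OF T j'] by blast
qed

lemma ssyt_from_below:
  assumes "T \<in> extensional (diagram l)"
    and n: "\<And>r j k. j < l r \<Longrightarrow> T (r, j) < k \<longleftrightarrow> j < n r k"
    and inter: "\<And>r k. n (Suc r) (Suc k) \<le> n r k"
  shows "T \<in> ssyt l"
  unfolding ssyt_def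
proof (intro CollectI conjI allI impI)
  show "T \<in> extensional (diagram l)" by fact
next
  fix i j assume "(i, Suc j) \<in> diagram l"
  then have j: "Suc j < l i" by (simp add: diagram_def)
  then have "Suc j < n i (Suc (T (i, Suc j)))" using n by blast
  then have "T (i, j) < Suc (T (i, Suc j))" using n[of j i] j by simp
  then show "T (i, j) \<le> T (i, Suc j)" by simp
next
  fix i j assume "(Suc i, j) \<in> diagram l"
  then have j: "j < l (Suc i)" by (simp add: diagram_def)
  then have j': "j < l i" using antimonoD[OF antimono, of i "Suc i"] by simp
  have "j < n (Suc i) (Suc (T (Suc i, j)))" using n j by blast
  then have "j < n i (T (Suc i, j))" using inter less_le_trans by blast
  then show "T (i, j) < T (Suc i, j)" using n j' by blast
qed

definition lo where "lo i T r = max (below T r i) (below T (Suc r) (Suc (Suc i)))"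

definition hi where
  "hi i T r = (if r = 0 then below T r (Suc (Suc i))
     else min (below T (r - 1) i) (below T r (Suc (Suc i))))"

definition new_below where
  "new_below i T r = lo i T r + hi i T r - below T r (Suc i)"

definition below' where
  "below' i T r k = (if k = Suc i then new_below i T r else below T r k)"

definition toggle :: "nat \<Rightarrow> (nat \<times> nat \<Rightarrow> nat) \<Rightarrow> nat \<times> nat \<Rightarrow> nat" where
  "toggle i T = (\<lambda>(r, j). if (r, j) \<in> diagram l \<and> T (r, j) \<in> {i, Suc i}
     then (if j < new_below i T r then i else Suc i) else T (r, j))"

context
  fixes i :: nat and T :: "nat \<times> nat \<Rightarrow> nat"
  assumes T: "T \<in> ssyt l"
begin

lemma lo_le: "lo i T r \<le> below T r (Suc i)"
  unfolding lo_def using below_mono[of i "Suc i" T r] below_interlace[OF T, of r "Suc i"] by simp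

lemma le_hi: "below T r (Suc i) \<le> hi i T r"
  unfolding hi_def using below_mono[of "Suc i" "Suc (Suc i)" T r]
    below_interlace[OF T, of "r - 1" i] by auto

lemma new_below_bounds: "lo i T r \<le> new_below i T r" "new_below i T r \<le> hi i T r"
  using lo_le[of r] le_hi[of r] unfolding new_below_def by linarith+

lemma new_below_bounds':
  "below T r i \<le> new_below i T r" "new_below i T r \<le> below T r (Suc (Suc i))"
  using new_below_bounds[of r] unfolding lo_def hi_def by (auto split: if_splits)

lemma toggle_less_iff:
  assumes j: "j < l r"
  shows "toggle i T (r, j) < k \<longleftrightarrow> j < below' i T r k"
proof -
  have iff: "T (r, j) < k \<longleftrightarrow> j < below T r k" for k by (rule below_iff[OF T j])
  have d: "(r, j) \<in> diagram l" using j by (simp add: diagram_def)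
  consider "T (r, j) < i" | "T (r, j) = i \<or> T (r, j) = Suc i" | "T (r, j) \<ge> Suc (Suc i)"
    by linarith
  then show ?thesis
  proof cases
    case 1
    then have "toggle i T (r, j) = T (r, j)" by (simp add: toggle_def)
    moreover have "j < new_below i T r"
      using 1 iff[of i] new_below_bounds'(1)[of r] by linarith
    ultimately show ?thesis using 1 iff[of k] by (cases "k = Suc i") (simp_all add: below'_def)
  next
    case 2
    then have t: "toggle i T (r, j) = (if j < new_below i T r then i else Suc i)"
      using d by (simp add: toggle_def)
    show ?thesis
    proof (cases "k = Suc i")
      case True
      then show ?thesis by (simp add: t below'_def)
    next
      case False
      then have "toggle i T (r, j) < k \<longleftrightarrow> T (r, j) < k"
        using 2 unfolding t by (cases "j < new_below i T r") auto
      then show ?thesis using False iff[of k] by (simp add: below'_def)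
    qed
  next
    case 3
    then have "toggle i T (r, j) = T (r, j)" by (simp add: toggle_def)
    moreover have "\<not> j < new_below i T r"
      using 3 iff[of "Suc (Suc i)"] new_below_bounds'(2)[of r] by linarith
    ultimately show ?thesis using 3 iff[of k] by (cases "k = Suc i") (simp_all add: below'_def)
  qed
qed

lemma below'_interlace: "below' i T (Suc r) (Suc k) \<le> below' i T r k"
proof -
  consider "k = i" | "k = Suc i" | "k \<noteq> i" "k \<noteq> Suc i" by blast
  then show ?thesis
  proof cases
    case 1
    then show ?thesis using new_below_bounds(2)[of "Suc r"] by (simp add: below'_def hi_def)
  next
    case 2
    then show ?thesis using new_below_bounds(1)[of r] by (simp add: below'_def lo_def)
  next
    case 3
    then show ?thesis using below_interlace[OF T, of r k] by (simp add: below'_def)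
  qed
qed

lemma toggle_ssyt: "toggle i T \<in> ssyt l"
proof (rule ssyt_from_below[where n = "below' i T"])
  have "T \<in> extensional (diagram l)" using T by (simp add: ssyt_def)
  then show "toggle i T \<in> extensional (diagram l)"
    by (auto simp: toggle_def extensional_def)
next
  show "toggle i T (r, j) < k \<longleftrightarrow> j < below' i T r k" if "j < l r" for r j k
    using that by (rule toggle_less_iff)
  show "below' i T (Suc r) (Suc k) \<le> below' i T r k" for r k
    by (rule below'_interlace)
qed

lemma below_toggle: "below (toggle i T) r k = below' i T r k"
proof (rule belowI)
  show "below' i T r k \<le> l r"
    using below_le[of T r k] below_le[of T r "Suc (Suc i)"] new_below_bounds'(2)[of r]
    by (auto simp: below'_def)
qed (rule toggle_less_iff)

lemma new_below_toggle: "new_below i (toggle i T) r = below T r (Suc i)"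
proof -
  have "lo i (toggle i T) r = lo i T r" "hi i (toggle i T) r = hi i T r"
    by (simp_all add: lo_def hi_def below_toggle below'_def)
  then show ?thesis
    unfolding new_below_def[of i "toggle i T"]
    using lo_le[of r] le_hi[of r] by (simp add: below_toggle below'_def new_below_def)
qed

lemma toggle_toggle: "toggle i (toggle i T) = T"
proof
  fix p :: "nat \<times> nat"
  obtain r j where p: "p = (r, j)" by force
  show "toggle i (toggle i T) p = T p"
  proof (cases "(r, j) \<in> diagram l \<and> T (r, j) \<in> {i, Suc i}")
    case True
    then have "toggle i T (r, j) \<in> {i, Suc i}" by (auto simp: toggle_def)
    moreover have "j < below T r (Suc i) \<longleftrightarrow> T (r, j) < Suc i"
      using True below_iff[OF T, of j r] by (auto simp: diagram_def)
    ultimately show ?thesis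
      using True unfolding p toggle_def[of i "toggle i T"] new_below_toggle by auto
  next
    case False
    then have "toggle i T (r, j) = T (r, j)" by (auto simp: toggle_def)
    moreover from this have "toggle i (toggle i T) (r, j) = toggle i T (r, j)"
      using False unfolding toggle_def[of i "toggle i T"] by auto
    ultimately show ?thesis by (simp add: p)
  qed
qed

lemma sum_lo_hi:
  "(\<Sum>r<n. lo i T r + hi i T r) + hi i T n
     = (\<Sum>r<n. below T r i + below T r (Suc (Suc i))) + below T n (Suc (Suc i))"
proof (induction n)
  case 0
  show ?case by (simp add: hi_def)
next
  case (Suc n)
  have "lo i T n + hi i T (Suc n) = below T n i + below T (Suc n) (Suc (Suc i))"
    by (simp add: lo_def hi_def)
  with Suc show ?case by simp
qed

lemma sum_new_below:
  "(\<Sum>r<rows. new_below i T r + below T r (Suc i))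
     = (\<Sum>r<rows. below T r i + below T r (Suc (Suc i)))"
proof -
  have z: "below T rows (Suc (Suc i)) = 0" using below_le[of T rows "Suc (Suc i)"] rows by simp
  then have "hi i T rows = 0" by (auto simp: hi_def)
  moreover have "new_below i T r + below T r (Suc i) = lo i T r + hi i T r" for r
    using lo_le[of r] le_hi[of r] by (simp add: new_below_def)
  ultimately show ?thesis using sum_lo_hi[of rows] z by simp
qed

lemma count_content: "count (tableau_content l S) x + (\<Sum>r<rows. below S r x) = (\<Sum>r<rows. below S r (Suc x))"
proof -
  have "count (tableau_content l S) x = card {p \<in> diagram l. S p = x}"
    by (simp add: tableau_content_def count_image_mset finite_diagram vimage_def Int_def conj_commute)
  also have "{p \<in> diagram l. S p = x} = (SIGMA r:{..<rows}. {j. j < l r \<and> S (r, j) = x})"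
    by (auto simp: diagram_eq)
  also have "card \<dots> = (\<Sum>r<rows. card {j. j < l r \<and> S (r, j) = x})"
    by (subst card_SigmaI) auto
  finally have c: "count (tableau_content l S) x = (\<Sum>r<rows. card {j. j < l r \<and> S (r, j) = x})" .
  have "below S r (Suc x) = card {j. j < l r \<and> S (r, j) = x} + below S r x" for r
  proof -
    have "{j. j < l r \<and> S (r, j) < Suc x} = {j. j < l r \<and> S (r, j) = x} \<union> {j. j < l r \<and> S (r, j) < x}"
      by auto
    then show ?thesis unfolding below_def by (simp add: card_Un_disjoint disjoint_iff)
  qed
  with c show ?thesis by (simp add: sum.distrib)
qed

lemma toggle_content:
  "tableau_content l (toggle i T) = image_mset (transpose i (Suc i)) (tableau_content l T)"
proof (rule multiset_eqI)
  fix x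
  let ?t = "transpose i (Suc i)"
  have rhs: "count (image_mset ?t M) x = count M (?t x)" for M
  proof (induction M)
    case (add y M)
    have "?t y = x \<longleftrightarrow> y = ?t x" by (metis transpose_involutory)
    with add show ?case by simp
  qed simp
  have s: "(\<Sum>r<rows. new_below i T r) + (\<Sum>r<rows. below T r (Suc i))
     = (\<Sum>r<rows. below T r i) + (\<Sum>r<rows. below T r (Suc (Suc i)))"
    using sum_new_below by (simp add: sum.distrib)
  have b: "(\<Sum>r<rows. below (toggle i T) r k)
      = (if k = Suc i then (\<Sum>r<rows. new_below i T r) else (\<Sum>r<rows. below T r k))" for k
    by (simp add: below_toggle below'_def)
  note c = count_content[of "toggle i T", unfolded b] count_content[of T]
  consider "x = i" | "x = Suc i" | "x \<noteq> i" "x \<noteq> Suc i" by blast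
  then have "count (tableau_content l (toggle i T)) x = count (tableau_content l T) (?t x)"
  proof cases
    case 1
    have "count (tableau_content l (toggle i T)) i = count (tableau_content l T) (Suc i)"
      using c(1)[of i] c(2)[of "Suc i"] s by (simp only: if_True if_False n_not_Suc_n refl)
    with 1 show ?thesis by simp
  next
    case 2
    have "count (tableau_content l (toggle i T)) (Suc i) = count (tableau_content l T) i"
      using c(1)[of "Suc i"] c(2)[of i] s
      by (simp only: if_True if_False Suc_n_not_n refl)
    with 2 show ?thesis by simp
  next
    case 3
    then have "count (tableau_content l (toggle i T)) x = count (tableau_content l T) x"
      using c(1)[of x] c(2)[of x] by (simp only: if_False nat.inject)
    moreover have "?t x = x" using 3 by (simp add: transpose_apply_other)
    ultimately show ?thesis by simp
  qed
  with rhs show "count (tableau_content l (toggle i T)) x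
      = count (image_mset ?t (tableau_content l T)) x" by simp
qed

end

lemma schur_series_adjacent:
  "schur_series l (image_mset (transpose i (Suc i)) m) = schur_series l m"
proof -
  let ?t = "transpose i (Suc i)"
  have tt: "image_mset ?t (image_mset ?t k) = k" for k
    by (simp add: multiset.map_comp comp_def)
  have "card {T \<in> ssyt l. tableau_content l T = m}
      = card {T \<in> ssyt l. tableau_content l T = image_mset ?t m}"
  proof (rule bij_betw_same_card[OF bij_betw_byWitness[where f = "toggle i" and f' = "toggle i"]])
    show "toggle i ` {T \<in> ssyt l. tableau_content l T = m}
        \<subseteq> {T \<in> ssyt l. tableau_content l T = image_mset ?t m}"
      by (clarsimp simp: toggle_ssyt toggle_content)
    show "toggle i ` {T \<in> ssyt l. tableau_content l T = image_mset ?t m}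
        \<subseteq> {T \<in> ssyt l. tableau_content l T = m}"
      by (clarsimp simp only: toggle_ssyt toggle_content tt mem_Collect_eq image_subset_iff simp_thms)
  qed (simp_all add: toggle_toggle)
  then show ?thesis by (simp add: schur_series_def)
qed

end

lemma symmetric_series_adjacentI:
  assumes adj: "\<And>i m. f (image_mset (transpose i (Suc i)) m) = f m"
  shows "symmetric_series f"
proof -
  have *: "f (image_mset (transpose a (Suc (a + n))) m) = f m" for a n m
  proof (induction n arbitrary: m)
    case 0
    show ?case by (simp add: adj)
  next
    case (Suc n)
    let ?u = "transpose (Suc (a + n)) (Suc (Suc (a + n)))" and ?v = "transpose a (Suc (a + n))"
    have "transpose a (Suc (Suc (a + n))) = ?v \<circ> ?u \<circ> ?v"
      by (subst transpose_comp_triple) auto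
    then have "image_mset (transpose a (Suc (a + Suc n))) m
        = image_mset ?v (image_mset ?u (image_mset ?v m))"
      by (simp add: multiset.map_comp comp_assoc)
    then show ?case by (simp only: Suc.IH adj)
  qed
  have swap: "f (image_mset (transpose a b) m) = f m" for a b m
  proof (cases a b rule: linorder_cases)
    case less
    then obtain n where "b = Suc (a + n)" using less_imp_Suc_add by blast
    then show ?thesis using * by blast
  next
    case equal
    then show ?thesis by simp
  next
    case greater
    then obtain n where "a = Suc (b + n)" using less_imp_Suc_add by blast
    then show ?thesis using *[of b n m] by (simp add: transpose_commute)
  qed
  have "f (image_mset p m) = f m" if "swapidseq n p" for n p m
    using that
  proof (induction arbitrary: m)
    case (comp_Suc n p a b)
    have "image_mset (transpose a b \<circ> p) m = image_mset (transpose a b) (image_mset p m)"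
      by (simp add: multiset.map_comp)
    then show ?case by (simp only: swap comp_Suc.IH)
  qed simp
  then show ?thesis unfolding symmetric_series_def permutation_def by blast
qed

lift_definition schur :: "partition \<Rightarrow> symfun" is schur_series
proof
  fix l :: "nat \<Rightarrow> nat"
  assume "antimono l \<and> finite {i. l i \<noteq> 0}"
  then interpret fixed_shape l by unfold_locales auto
  show "symmetric_series (schur_series l)"
    by (rule symmetric_series_adjacentI) (rule schur_series_adjacent)
  have "size m \<le> card (diagram l)" if "schur_series l m \<noteq> 0" for m
  proof -
    have "{T \<in> ssyt l. tableau_content l T = m} \<noteq> {}"
      using that unfolding schur_series_def by (metis card.empty of_nat_0)
    then show ?thesis using size_content by auto
  qed
  then show "bounded_degree (schur_series l)" unfolding bounded_degree_def by blast
qed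

definition schur_in :: "partition \<Rightarrow> 'r::{comm_ring, comm_monoid_mult} Lambda" where
  "schur_in l = 1 \<otimes>\<^sub>\<int> schur l"


section \<open>Products of complementary Schur functions\<close>

definition complementary_pairs :: "nat \<Rightarrow> nat \<Rightarrow> partition set set" where
  "complementary_pairs a b = {{l, complement a b l} | l. l \<subseteq>\<^sub>p rectangle a b}"

text \<open>
  The choice of the representative \<open>l\<close> is immaterial by the lemma \<open>pair_product\<close> below.  For a
  self-complementary \<open>l\<close> the pair is a singleton and the product is the square of the Schur function.
\<close>

definition pair_product :: "nat \<Rightarrow> nat \<Rightarrow> partition set \<Rightarrow> 'r::{comm_ring, comm_monoid_mult} Lambda" where
  "pair_product a b P = (let l = SOME l. l \<in> P in schur_in l * schur_in (complement a b l))"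

lemma complement_le: "complement a b l \<subseteq>\<^sub>p rectangle a b"
  unfolding part_le_def by transfer auto

lemma complement_complement:
  assumes "l \<subseteq>\<^sub>p rectangle a b"
  shows "complement a b (complement a b l) = l"
proof -
  have "part (complement a b (complement a b l)) i = part l i" for i
  proof (cases "i < a")
    case True
    then have "part l i \<le> b"
      using assms[unfolded part_le_def, rule_format, of i] by (simp add: rectangle.rep_eq)
    moreover have "a - 1 - i < a" "a - 1 - (a - 1 - i) = i" using True by linarith+
    ultimately show ?thesis using True by (simp only: complement.rep_eq if_True diff_diff_cancel)
  next
    case False
    then show ?thesis
      using assms[unfolded part_le_def, rule_format, of i]
      by (simp add: complement.rep_eq rectangle.rep_eq)
  qed
  then show ?thesis by (simp add: fun_eq_iff flip: part_inject)
qed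

lemma pair_product:
  assumes "l \<subseteq>\<^sub>p rectangle a b"
  shows "pair_product a b {l, complement a b l} = schur_in l * schur_in (complement a b l)"
proof -
  define x where "x = (SOME x. x \<in> {l, complement a b l})"
  have "x \<in> {l, complement a b l}" unfolding x_def by (rule someI[of _ l]) simp
  then have "schur_in x * schur_in (complement a b x)
      = (schur_in l * schur_in (complement a b l) :: 'a Lambda)"
    using complement_complement[OF assms] by (auto simp: mult.commute)
  then show ?thesis by (simp only: pair_product_def Let_def x_def)
qed

definition linearly_independent_family ::
    "('r::zero \<Rightarrow> 'm::comm_monoid_add \<Rightarrow> 'm) \<Rightarrow> 'i set \<Rightarrow> ('i \<Rightarrow> 'm) \<Rightarrow> bool" where
  "linearly_independent_family scale I f \<longleftrightarrow>
     (\<forall>J c. finite J \<and> J \<subseteq> I \<and> (\<Sum>i\<in>J. scale (c i) (f i)) = 0 \<longrightarrow> (\<forall>i\<in>J. c i = 0))"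

end

(*
  Let h_k^perp, E and p_m^perp denote the adjoints of the multiplications by h_k, by the series
  sum_j (-t)^j e_j, and by the power sum p_m.  For d = lambda_1 + mu_1 the operator h_d^perp turns
  s_lambda s_mu into the product of the Schur functions with the first rows removed, and it
  annihilates the products with smaller first rows.  Doing this a div 2 times reduces a relation
  between the s_lambda s_(lambda^v) to one between products s_alpha s_beta of the lower halves, where
  now alpha + beta = sigma is the same for all pairs, and the lower halves determine lambda.

  The derivation p_m^perp maps s_alpha to 0 if m exceeds the length of the principal hook of alpha, and
  to a sign times s_(alpha^-) if it equals it, where alpha^- is alpha without its first row and
  column.  For the largest hook length m that occurs, p_m^perp therefore turns the relation into one
  between the s_(alpha^-) s_(sigma - alpha).  Their leading monomials alpha^- + sigma - alpha are
  distinct because together with sigma they determine alpha row by row from the bottom.  A pair with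
  alpha = beta appears with coefficient 2 c here; it is treated last, when it is the only one left.
*)

theory Submission
  imports Defs "HOL-Computational_Algebra.Formal_Power_Series"
begin

section \<open>Extracting powers of a fresh variable\<close>

text \<open>\<open>symmetric_series\<close> speaks only of finitary permutations, while shifts such
  as \<open>Suc\<close> are merely injective. On the finite support, \<open>g\<close> extends to
  such a permutation by mapping \<open>?B - ?A\<close> bijectively onto
  \<open>?A - ?B\<close>.\<close>

lemma symmetric_series_inj:
  assumes f: "symmetric_series f" and g: "inj_on g (set_mset m)"
  shows "f (image_mset g m) = f m"
proof -
  let ?A = "set_mset m" and ?B = "g ` set_mset m"
  have "card ?B = card ?A" using g by (simp add: card_image)
  then have "card (?B - ?A) = card (?A - ?B)"
    by (simp add: card_Diff_subset_Int Int_commute)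
  then obtain h where h: "bij_betw h (?B - ?A) (?A - ?B)"
    using finite_same_card_bij[of "?B - ?A" "?A - ?B"] by auto
  define p where "p x = (if x \<in> ?A then g x else if x \<in> ?B - ?A then h x else x)" for x
  have "bij_betw p ?A ?B"
    using g by (auto simp: p_def bij_betw_def inj_on_def)
  moreover have "bij_betw p (?B - ?A) (?A - ?B)"
    using h by (rule bij_betw_cong[THEN iffD1, rotated]) (auto simp: p_def)
  ultimately have "bij_betw p (?A \<union> (?B - ?A)) (?B \<union> (?A - ?B))"
    by (rule bij_betw_combine) auto
  then have "bij_betw p (?A \<union> ?B) (?A \<union> ?B)" by (simp add: Un_commute)
  then have "p permutes (?A \<union> ?B)"
    by (rule bij_imp_permutes) (auto simp: p_def)
  then have "permutation p"
    by (rule permutes_imp_permutation[rotated]) simp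
  then have "f (image_mset p m) = f m" using f by (simp add: symmetric_series_def)
  moreover have "image_mset p m = image_mset g m"
    by (rule image_mset_cong) (simp add: p_def)
  ultimately show ?thesis by simp
qed

text \<open>Expanding \<open>f\<close> in powers of the variable 0 and shifting the other variables
  down yields \<open>h_k^perp f\<close> as the coefficient of the \<open>k\<close>-th power. No
  inner product enters.\<close>

lift_definition skew_h :: "nat \<Rightarrow> symfun \<Rightarrow> symfun"
  is "\<lambda>k f m. f (replicate_mset k 0 + image_mset Suc m)"
proof
  fix k and f :: "nat multiset \<Rightarrow> int"
  assume "symmetric_series f \<and> bounded_degree f"
  then have f: "symmetric_series f" and "bounded_degree f" by auto
  then obtain d where d: "\<And>m. f m \<noteq> 0 \<Longrightarrow> size m \<le> d"
    unfolding bounded_degree_def by blast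
  show "symmetric_series (\<lambda>m. f (replicate_mset k 0 + image_mset Suc m))"
    unfolding symmetric_series_def
  proof (intro allI impI)
    fix p :: "nat \<Rightarrow> nat" and m assume "permutation p"
    then have p: "inj p" by (rule permutation_bijective[THEN bij_is_inj])
    \<comment> \<open>\<open>?q\<close> carries \<open>p\<close> through the shift and fixes the
      extracted variable.\<close>
    let ?q = "case_nat 0 (\<lambda>x. Suc (p x))"
    have "inj ?q" using p by (intro injI) (auto split: nat.splits dest: injD)
    then have "f (image_mset ?q (replicate_mset k 0 + image_mset Suc m))
        = f (replicate_mset k 0 + image_mset Suc m)"
      by (intro symmetric_series_inj[OF f]) (rule inj_on_subset[OF _ subset_UNIV])
    then show "f (replicate_mset k 0 + image_mset Suc (image_mset p m))
        = f (replicate_mset k 0 + image_mset Suc m)"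
      by (simp add: multiset.map_comp comp_def)
  qed
  show "bounded_degree (\<lambda>m. f (replicate_mset k 0 + image_mset Suc m))"
    unfolding bounded_degree_def
  proof (intro exI[of _ d] allI impI)
    fix m assume "f (replicate_mset k 0 + image_mset Suc m) \<noteq> 0"
    then show "size m \<le> d" using d by fastforce
  qed
qed

lemma coeff_skew_h: "symfun_coeff (skew_h k f) m = symfun_coeff f (replicate_mset k 0 + image_mset Suc m)"
  by (simp add: skew_h.rep_eq)

text \<open>By symmetry any variable that does not occur in \<open>m\<close> can be extracted in
  place of the variable 0, in particular one above all entries of \<open>m\<close>.\<close>

lemma coeff_skew_h_fresh:
  assumes "n \<notin># m"
  shows "symfun_coeff (skew_h k f) m = symfun_coeff f (replicate_mset k n + m)"
proof -
  let ?g = "case_nat n (\<lambda>x. x)"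
  have f: "symmetric_series (symfun_coeff f)" using symfun_coeff[of f] by simp
  have "symfun_coeff f (image_mset ?g (replicate_mset k 0 + image_mset Suc m))
      = symfun_coeff f (replicate_mset k 0 + image_mset Suc m)"
    by (rule symmetric_series_inj[OF f])
      (use assms in \<open>auto simp: inj_on_def split: nat.splits\<close>)
  then show ?thesis
    by (simp add: coeff_skew_h multiset.map_comp comp_def)
qed

lemma skew_h_0 [simp]: "skew_h 0 f = f"
proof -
  have "symfun_coeff (skew_h 0 f) m = symfun_coeff f m" for m
  proof -
    obtain n where "n \<notin># m" using ex_new_if_finite[of "set_mset m"] by auto
    then show ?thesis by (simp add: coeff_skew_h_fresh)
  qed
  then show ?thesis by (simp add: fun_eq_iff flip: symfun_coeff_inject)
qed

lemma skew_h_add: "skew_h k (f + g) = skew_h k f + skew_h k g"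
  by transfer simp

lemma skew_h_zero [simp]: "skew_h k 0 = 0"
  by transfer simp

lemma skew_h_uminus: "skew_h k (- f) = - skew_h k f"
  by transfer simp

lemma skew_h_sum: "skew_h k (sum f A) = (\<Sum>x\<in>A. skew_h k (f x))"
  by (induction A rule: infinite_finite_induct) (simp_all add: skew_h_add)

lemma coeff_zero [simp]: "symfun_coeff 0 m = 0"
  by (simp add: zero_symfun.rep_eq)

lemma coeff_add: "symfun_coeff (f + g) m = symfun_coeff f m + symfun_coeff g m"
  by (simp add: plus_symfun.rep_eq)

lemma coeff_uminus: "symfun_coeff (- f) m = - symfun_coeff f m"
  by (simp add: uminus_symfun.rep_eq)

lemma coeff_sum: "symfun_coeff (sum f A) m = (\<Sum>x\<in>A. symfun_coeff (f x) m)"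
  by (induction A rule: infinite_finite_induct) (simp_all add: coeff_add)

lemma coeff_mult: "symfun_coeff (f * g) m
    = (\<Sum>(k, l) \<in> {(k, l). k + l = m}. symfun_coeff f k * symfun_coeff g l)"
  by (simp add: times_symfun.rep_eq series_mult_def)

lemma symfun_eqI: "(\<And>m. symfun_coeff f m = symfun_coeff g m) \<Longrightarrow> f = g"
  by (simp add: fun_eq_iff flip: symfun_coeff_inject)

lemma mset_zero_Suc_cases:
  obtains k m where "M = replicate_mset k 0 + image_mset Suc m"
proof -
  have "\<exists>k m. M = replicate_mset k 0 + image_mset Suc m"
  proof (induction M)
    case (add x M)
    then obtain k m where M: "M = replicate_mset k 0 + image_mset Suc m" by blast
    show ?case
    proof (cases x)
      case 0
      with M have "add_mset x M = replicate_mset (Suc k) 0 + image_mset Suc m" by simp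
      then show ?thesis by blast
    next
      case (Suc y)
      with M have "add_mset x M = replicate_mset k 0 + image_mset Suc (add_mset y m)" by simp
      then show ?thesis by blast
    qed
  qed simp
  with that show thesis by blast
qed

lemma zero_Suc_mset_eq_iff:
  "replicate_mset k 0 + image_mset Suc m = replicate_mset l 0 + image_mset Suc n \<longleftrightarrow> k = l \<and> m = n"
proof
  assume eq: "replicate_mset k 0 + image_mset Suc m = replicate_mset l 0 + image_mset Suc n"
  have c: "count (image_mset Suc m) 0 = 0" for m
    by (simp add: not_in_iff[symmetric])
  have "k = l" using arg_cong[OF eq, of "\<lambda>M. count M 0"] by (simp add: c)
  with eq have "image_mset Suc m = image_mset Suc n" by simp
  then have "image_mset (\<lambda>x. x - 1) (image_mset Suc m) = image_mset (\<lambda>x. x - 1) (image_mset Suc n)"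
    by simp
  with \<open>k = l\<close> show "k = l \<and> m = n" by (simp add: multiset.map_comp comp_def)
qed auto

text \<open>The \<open>k\<close> copies of the variable 0 are distributed over the two factors; this
  is the coproduct of \<open>h_k\<close>.\<close>

lemma skew_h_mult: "skew_h k (f * g) = (\<Sum>i\<le>k. skew_h i f * skew_h (k - i) g)"
proof (rule symfun_eqI)
  fix m
  let ?z = "\<lambda>i (u :: nat multiset). replicate_mset i 0 + image_mset Suc u"
  have "symfun_coeff (\<Sum>i\<le>k. skew_h i f * skew_h (k - i) g) m
      = (\<Sum>i\<le>k. \<Sum>(u, v) \<in> {(u, v). u + v = m}.
          symfun_coeff f (?z i u) * symfun_coeff g (?z (k - i) v))"
    by (simp add: coeff_sum coeff_mult coeff_skew_h)
  also have "\<dots> = (\<Sum>(i, u, v) \<in> {..k} \<times> {(u, v). u + v = m}.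
          symfun_coeff f (?z i u) * symfun_coeff g (?z (k - i) v))"
    by (subst sum.cartesian_product) (simp add: case_prod_beta)
  also have "\<dots> = (\<Sum>(p, q) \<in> {(p, q). p + q = ?z k m}. symfun_coeff f p * symfun_coeff g q)"
  proof (rule sum.reindex_bij_betw[of "\<lambda>(i, u, v). (?z i u, ?z (k - i) v)", THEN trans[rotated]])
    show "bij_betw (\<lambda>(i, u, v). (?z i u, ?z (k - i) v))
        ({..k} \<times> {(u, v). u + v = m}) {(p, q). p + q = ?z k m}"
      unfolding bij_betw_def
    proof
      show "inj_on (\<lambda>(i, u, v). (?z i u, ?z (k - i) v)) ({..k} \<times> {(u, v). u + v = m})"
        by (auto simp: inj_on_def zero_Suc_mset_eq_iff)
      show "(\<lambda>(i, u, v). (?z i u, ?z (k - i) v)) ` ({..k} \<times> {(u, v). u + v = m})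
          = {(p, q). p + q = ?z k m}" (is "?f ` ?A = ?B")
      proof
        have add: "?z i u + ?z j v = ?z (i + j) (u + v)" for i j u v
          by (auto intro!: multiset_eqI)
        then show "?f ` ?A \<subseteq> ?B" by auto
        show "?B \<subseteq> ?f ` ?A"
        proof clarify
          fix p q assume pq: "p + q = ?z k m"
          obtain i u where p: "p = ?z i u" by (rule mset_zero_Suc_cases)
          obtain j v where q: "q = ?z j v" by (rule mset_zero_Suc_cases)
          have "k = i + j \<and> m = u + v"
            using pq unfolding p q add by (simp only: zero_Suc_mset_eq_iff) 
          then show "(p, q) \<in> ?f ` ?A" unfolding p q
            by (intro image_eqI[of _ _ "(i, u, v)"]) auto
        qed
      qed
    qed
  qed (auto simp: case_prod_beta)
  also have "\<dots> = symfun_coeff (skew_h k (f * g)) m" by (simp add: coeff_skew_h coeff_mult)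
  finally show "symfun_coeff (skew_h k (f * g)) m
      = symfun_coeff (\<Sum>i\<le>k. skew_h i f * skew_h (k - i) g) m" by simp
qed


section \<open>The adjoint of a power sum as a derivation\<close>

unbundle fps_syntax

text \<open>The operator \<open>sum_i w_i t^i h_i^perp\<close>, extended linearly in
  \<open>t\<close> to power series. The weights 1 give the adjoint of \<open>H(t)\<close>, the
  weights \<open>of_nat\<close> that of \<open>t H'(t)\<close>.\<close>

definition skew_fps :: "(nat \<Rightarrow> symfun) \<Rightarrow> symfun fps \<Rightarrow> symfun fps" where
  "skew_fps w F = Abs_fps (\<lambda>n. \<Sum>i\<le>n. w i * skew_h i (F $ (n - i)))"

text \<open>A weight that splits at \<open>i + j\<close> into two products makes the operator split
  in the same way on products. Two summands serve both uses: \<open>1 = 1 * 1 + 0 * 0\<close> for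
  multiplicativity and \<open>i + j = i * 1 + 1 * j\<close> for a derivation.\<close>

lemma skew_fps_mult:
  assumes "\<And>i j. w (i + j) = u i * v j + u' i * v' j"
  shows "skew_fps w (F * G) = skew_fps u F * skew_fps v G + skew_fps u' F * skew_fps v' G"
proof (rule fps_ext)
  fix n :: nat
  let ?t = "\<lambda>i j. skew_h i (F $ j)" and ?s = "\<lambda>i j. skew_h i (G $ j)"
  let ?S = "SIGMA p:{..n}. {..p} \<times> {..n - p}"
  have prod: "(skew_fps u F * skew_fps v G) $ n
      = (\<Sum>(p, i, k) \<in> ?S. u i * v k * (?t i (p - i) * ?s k (n - p - k)))" for u v
    by (simp add: skew_fps_def fps_mult_nth sum_product sum.cartesian_product sum.Sigma
        atLeast0AtMost case_prod_beta mult_ac)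
  have "skew_fps w (F * G) $ n
      = (\<Sum>q\<le>n. \<Sum>j\<le>n - q. \<Sum>i\<le>q. w q * (?t i j * ?s (q - i) (n - q - j)))"
    by (simp add: skew_fps_def fps_mult_nth skew_h_sum skew_h_mult sum_distrib_left atLeast0AtMost)
  also have "\<dots> = (\<Sum>(q, j, i) \<in> (SIGMA q:{..n}. {..n - q} \<times> {..q}).
      w q * (?t i j * ?s (q - i) (n - q - j)))"
    by (simp add: sum.cartesian_product sum.Sigma case_prod_beta)
  \<comment> \<open>Here \<open>p = i + j\<close> is the total degree in \<open>t\<close>
    contributed by \<open>F\<close>, and \<open>k = q - i\<close> is the part of \<open>q\<close>
    that acts on \<open>G\<close>.\<close>
  also have "\<dots> = (\<Sum>(p, i, k) \<in> ?S. w (i + k) * (?t i (p - i) * ?s k (n - p - k)))"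
    by (rule sum.reindex_bij_witness[where
          i = "\<lambda>(p, i, k). (i + k, p - i, i)" and j = "\<lambda>(q, j, i). (i + j, i, q - i)"])
      (auto simp: add.commute)
  also have "\<dots> = (\<Sum>(p, i, k) \<in> ?S. u i * v k * (?t i (p - i) * ?s k (n - p - k)))
      + (\<Sum>(p, i, k) \<in> ?S. u' i * v' k * (?t i (p - i) * ?s k (n - p - k)))"
    by (simp add: assms case_prod_beta distrib_right sum.distrib)
  finally show "skew_fps w (F * G) $ n
      = (skew_fps u F * skew_fps v G + skew_fps u' F * skew_fps v' G) $ n"
    by (simp add: prod)
qed

lemma skew_fps_add: "skew_fps w (F + G) = skew_fps w F + skew_fps w G"
  by (simp add: skew_fps_def fps_eq_iff skew_h_add sum.distrib distrib_left)

abbreviation "skew_all \<equiv> skew_fps (\<lambda>_. 1)"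

lemma skew_all_nth_Suc: "skew_all F $ n = F $ n + (\<Sum>i\<in>{1..n}. skew_h i (F $ (n - i)))"
  by (simp add: skew_fps_def atMost_atLeast0 sum.atLeast_Suc_atMost)

text \<open>The term \<open>i = 0\<close> is the identity, so the system for the coefficients is
  unitriangular.\<close>

lemma skew_all_inj:
  assumes "skew_all F = skew_all G"
  shows "F = G"
proof (rule fps_ext)
  fix n :: nat
  show "F $ n = G $ n"
  proof (induction n rule: less_induct)
    case (less n)
    have "(\<Sum>i\<in>{1..n}. skew_h i (F $ (n - i))) = (\<Sum>i\<in>{1..n}. skew_h i (G $ (n - i)))"
      by (rule sum.cong) (simp_all add: less)
    moreover have "skew_all F $ n = skew_all G $ n" using assms by simp
    ultimately show ?case unfolding skew_all_nth_Suc by simp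
  qed
qed

text \<open>The recursion inverts the adjoint of \<open>H(t)\<close>. Since
  \<open>H(t) E(-t) = 1\<close>, the value is \<open>(-1)^n e_n^perp f\<close>.\<close>

fun skew_e_coeff :: "symfun \<Rightarrow> nat \<Rightarrow> symfun" where
  "skew_e_coeff f n = (if n = 0 then f else - (\<Sum>i\<in>{1..n}. skew_h i (skew_e_coeff f (n - i))))"

declare skew_e_coeff.simps [simp del]

definition skew_e :: "symfun \<Rightarrow> symfun fps" where
  "skew_e f = Abs_fps (skew_e_coeff f)"

lemma skew_all_skew_e: "skew_all (skew_e f) = fps_const f"
proof (rule fps_ext)
  fix n :: nat
  show "skew_all (skew_e f) $ n = fps_const f $ n"
    unfolding skew_all_nth_Suc
    by (cases "n = 0") (simp_all add: skew_e_def skew_e_coeff.simps)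
qed

lemma skew_e_unique: "skew_all F = fps_const f \<Longrightarrow> skew_e f = F"
  by (rule skew_all_inj) (simp add: skew_all_skew_e)

lemma skew_e_mult: "skew_e (f * g) = skew_e f * skew_e g"
proof (rule skew_e_unique)
  have "skew_all (skew_e f * skew_e g) = skew_all (skew_e f) * skew_all (skew_e g)"
    using skew_fps_mult[of "\<lambda>_. 1" "\<lambda>_. 1" "\<lambda>_. 1" "\<lambda>_. 0" "\<lambda>_. 0"]
    by (simp add: skew_fps_def[of "\<lambda>_. 0"] fps_eq_iff fps_mult_nth)
  then show "skew_all (skew_e f * skew_e g) = fps_const (f * g)"
    by (simp add: skew_all_skew_e)
qed

lemma skew_e_add: "skew_e (f + g) = skew_e f + skew_e g"
  by (rule skew_e_unique) (simp add: skew_fps_add skew_all_skew_e)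

text \<open>
  The operator adjoint to multiplication by the power sum \<open>p\<^sub>m\<close>, read off from \<open>P(t) = t H'(t) E(-t)\<close>.
\<close>

definition skew_p :: "nat \<Rightarrow> symfun \<Rightarrow> symfun" where
  "skew_p m f = skew_fps of_nat (skew_e f) $ m"

lemma skew_p_add: "skew_p m (f + g) = skew_p m f + skew_p m g"
  by (simp add: skew_p_def skew_e_add skew_fps_add)

text \<open>\<open>t H'(t)\<close> acts as a derivation relative to the multiplicative action of
  \<open>H(t)\<close>, and the latter collapses \<open>skew_e f\<close> and \<open>skew_e g\<close>
  to the constants \<open>f\<close> and \<open>g\<close>.\<close>

lemma skew_p_mult: "skew_p m (f * g) = skew_p m f * g + f * skew_p m g"
proof -
  have "skew_fps of_nat (skew_e f * skew_e g)
      = skew_fps of_nat (skew_e f) * skew_all (skew_e g) + skew_all (skew_e f) * skew_fps of_nat (skew_e g)"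
    by (rule skew_fps_mult) (simp add: of_nat_add)
  then show ?thesis by (simp add: skew_p_def skew_e_mult skew_all_skew_e)
qed


section \<open>Horizontal strips\<close>

lemma part_antimono: "i \<le> j \<Longrightarrow> part a j \<le> part a i"
  using part[of a] by (auto simp: antimono_def)

lemma fixed_shape_part: "fixed_shape (part a)"
  using part[of a] by unfold_locales auto

lemma part_eventually_zero: obtains N where "\<And>i. N \<le> i \<Longrightarrow> part a i = 0"
  by (rule that) (rule fixed_shape.rows[OF fixed_shape_part])

lemma part_eqI: "(\<And>i. part a i = part b i) \<Longrightarrow> a = b"
  by (simp add: fun_eq_iff flip: part_inject)

lemma part_Abs:
  assumes "\<And>i. f (Suc i) \<le> f i" "\<And>i. f i \<le> part a i"
  shows "part (Abs_partition f) = f"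
proof -
  have "{i. f i \<noteq> 0} \<subseteq> {i. part a i \<noteq> 0}" 
  proof
    fix i assume "i \<in> {i. f i \<noteq> 0}"
    then show "i \<in> {i. part a i \<noteq> 0}" using assms(2)[of i] by auto
  qed
  then have "finite {i. f i \<noteq> 0}" using part[of a] finite_subset by auto
  then show ?thesis
    using assms(1) by (simp add: Abs_partition_inverse antimono_iff_le_Suc)
qed

definition psize :: "partition \<Rightarrow> nat" where
  "psize a = card (diagram (part a))"

lemma finite_diagram_part: "finite (diagram (part a))"
  by (rule fixed_shape.finite_diagram[OF fixed_shape_part])

lemma psize_sum:
  assumes "part a N = 0"
  shows "psize a = (\<Sum>i<N. part a i)"
proof -
  have "diagram (part a) = (SIGMA i:{..<N}. {..<part a i})"
  proof -
    have "i < N" if "j < part a i" for i j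
      using that assms part_antimono[of N i a] by (cases "i < N") auto
    then show ?thesis by (auto simp: diagram_def)
  qed
  then show ?thesis by (simp add: psize_def)
qed

lemma finite_smaller_partitions: "finite {b. \<forall>i. part b i \<le> part a i}"
proof -
  obtain N where N: "\<And>i. N \<le> i \<Longrightarrow> part a i = 0" using part_eventually_zero[of a] by blast
  let ?S = "{b. \<forall>i. part b i \<le> part a i}" and ?r = "\<lambda>b. restrict (part b) {..<N}"
  have "inj_on ?r ?S"
  proof (rule inj_onI)
    fix b c assume b: "b \<in> ?S" and c: "c \<in> ?S" and eq: "?r b = ?r c"
    show "b = c"
    proof (rule part_eqI)
      fix i
      show "part b i = part c i"
      proof (cases "i < N")
        case True
        then show ?thesis using fun_cong[OF eq, of i] by simp
      next
        case False
        then have "part b i \<le> 0" "part c i \<le> 0" using N[of i] b c by (metis (mono_tags) leI mem_Collect_eq)+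
        then show ?thesis by simp
      qed
    qed
  qed
  moreover have "?r ` ?S \<subseteq> (\<Pi>\<^sub>E i\<in>{..<N}. {..part a i})"
    by (simp add: image_subset_iff restrict_PiE_iff)
  then have "finite (?r ` ?S)" by (rule finite_subset) (simp add: finite_PiE)
  ultimately show ?thesis by (rule finite_imageD[rotated])
qed

text \<open>The interlacing form of the condition that no column of \<open>a / b\<close> has two
  boxes.\<close>

definition hstrip :: "partition \<Rightarrow> partition \<Rightarrow> bool" where
  "hstrip a b \<longleftrightarrow> (\<forall>i. part b i \<le> part a i \<and> part a (Suc i) \<le> part b i)"

definition vstrip :: "partition \<Rightarrow> partition \<Rightarrow> bool" where
  "vstrip a b \<longleftrightarrow> (\<forall>i. part b i \<le> part a i \<and> part a i \<le> Suc (part b i))"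

lemma finite_hstrip: "finite {b. hstrip a b \<and> Q b}"
  by (rule finite_subset[OF _ finite_smaller_partitions[of a]]) (auto simp: hstrip_def)

lemma finite_vstrip: "finite {b. vstrip a b \<and> Q b}"
  by (rule finite_subset[OF _ finite_smaller_partitions[of a]]) (auto simp: vstrip_def)

lemma diagram_mono: "(\<And>i. part b i \<le> part a i) \<Longrightarrow> diagram (part b) \<subseteq> diagram (part a)"
  unfolding diagram_def using order.strict_trans2 by blast

lemma finite_ssyt_content: "finite {T \<in> ssyt (part a). tableau_content (part a) T = m}"
proof (rule finite_subset)
  show "{T \<in> ssyt (part a). tableau_content (part a) T = m}
      \<subseteq> (\<Pi>\<^sub>E p\<in>diagram (part a). set_mset m)"
    by (auto simp: ssyt_def tableau_content_def finite_diagram_part PiE_def)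
  show "finite (\<Pi>\<^sub>E p\<in>diagram (part a). set_mset m)"
    by (simp add: finite_PiE finite_diagram_part)
qed

text \<open>The boxes holding the largest entry \<open>n\<close> form a horizontal strip, and
  deleting them leaves a tableau of the smaller shape.\<close>

lemma card_ssyt_branching:
  assumes n: "\<And>x. x \<in># m \<Longrightarrow> x < n"
  shows "card {T \<in> ssyt (part a). tableau_content (part a) T = replicate_mset k n + m}
    = (\<Sum>b | hstrip a b \<and> psize b + k = psize a.
        card {T \<in> ssyt (part b). tableau_content (part b) T = m})"
proof -
  let ?D = "\<lambda>b. diagram (part b)"
  let ?B = "{b. hstrip a b \<and> psize b + k = psize a}"
  let ?X = "{T \<in> ssyt (part a). tableau_content (part a) T = replicate_mset k n + m}"
  let ?Y = "\<lambda>b. {T \<in> ssyt (part b). tableau_content (part b) T = m}"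
  interpret fixed_shape "part a" by (rule fixed_shape_part)
  \<comment> \<open>\<open>f\<close> fills the strip with \<open>n\<close>; outside
    \<open>?D a\<close> it must be \<open>undefined\<close> to be extensional.\<close>
  define f where "f = (\<lambda>(b, T) p. if p \<in> ?D b then T p else if p \<in> ?D a then n else undefined :: nat)"
  \<comment> \<open>The entries below \<open>n\<close> occupy an initial segment of each row, whose
    length is \<open>below T i n\<close>.\<close>
  define sh where "sh T = Abs_partition (\<lambda>i. below T i n)" for T
  define g where "g T = (sh T, restrict T (?D (sh T)))" for T
  have T_less: "T p < n" if "T \<in> ?Y b" "p \<in> ?D b" for T b p
  proof -
    have "T p \<in># tableau_content (part b) T"
      using that(2) by (auto simp: tableau_content_def finite_diagram_part)
    with that n show ?thesis by simp
  qed
  have T_le: "T p \<le> n" if "T \<in> ?X" "p \<in> ?D a" for T p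
  proof -
    have "T p \<in># tableau_content (part a) T"
      using that(2) by (auto simp: tableau_content_def finite_diagram_part)
    then have "T p \<in># replicate_mset k n + m" using that by simp
    then show ?thesis using n[of "T p"] by (auto split: if_splits)
  qed
  have f_in: "f (b, T) \<in> ?X" if b: "b \<in> ?B" and T: "T \<in> ?Y b" for b T
  proof -
    have hs: "hstrip a b" and sz: "psize b + k = psize a" using b by auto
    have sub: "?D b \<subseteq> ?D a" using hs by (intro diagram_mono) (simp add: hstrip_def)
    have "f (b, T) \<in> extensional (?D a)" using sub by (auto simp: f_def extensional_def)
    moreover have "f (b, T) (i, j) \<le> f (b, T) (i, Suc j)" if "(i, Suc j) \<in> ?D a" for i j
    proof (cases "(i, Suc j) \<in> ?D b")
      case True
      then have "(i, j) \<in> ?D b" by (simp add: diagram_def)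
      with True T show ?thesis by (simp add: f_def ssyt_def)
    next
      case False
      have "(i, j) \<in> ?D a" using that by (simp add: diagram_def)
      then show ?thesis using False that T_less[OF T, of "(i, j)"] by (auto simp: f_def)
    qed
    moreover have "f (b, T) (i, j) < f (b, T) (Suc i, j)" if "(Suc i, j) \<in> ?D a" for i j
    proof -
      \<comment> \<open>Interlacing puts the box above any box of \<open>a\<close> into
        \<open>b\<close>, so no two of the new entries \<open>n\<close> are stacked.\<close>
      have ij: "(i, j) \<in> ?D b"
        using that hs by (auto simp: hstrip_def diagram_def intro: order.strict_trans2)
      show ?thesis
      proof (cases "(Suc i, j) \<in> ?D b")
        case True
        with ij T show ?thesis by (simp add: f_def ssyt_def)
      next
        case False
        then show ?thesis using ij that T_less[OF T ij] by (simp add: f_def)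
      qed
    qed
    ultimately have "f (b, T) \<in> ssyt (part a)" by (simp add: ssyt_def)
    moreover have "tableau_content (part a) (f (b, T)) = replicate_mset k n + m"
    proof -
      have "?D a = ?D b \<union> (?D a - ?D b)" using sub by blast
      then have "mset_set (?D a) = mset_set (?D b) + mset_set (?D a - ?D b)"
        by (metis Diff_disjoint finite_Diff finite_diagram_part mset_set_Union)
      moreover have "image_mset (f (b, T)) (mset_set (?D b)) = tableau_content (part b) T"
        unfolding tableau_content_def
        by (rule image_mset_cong) (simp add: f_def finite_diagram_part)
      moreover have "image_mset (f (b, T)) (mset_set (?D a - ?D b)) = replicate_mset k n"
      proof -
        have "image_mset (f (b, T)) (mset_set (?D a - ?D b)) = image_mset (\<lambda>_. n) (mset_set (?D a - ?D b))"
          by (rule image_mset_cong) (simp add: f_def finite_diagram_part)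
        moreover have "card (?D a - ?D b) = k"
          using sz sub card_Diff_subset[OF finite_diagram_part sub] by (simp add: psize_def)
        ultimately show ?thesis by (simp add: image_mset_const_eq)
      qed
      ultimately show ?thesis using T by (simp add: tableau_content_def)
    qed
    ultimately show ?thesis by simp
  qed
  have part_sh: "part (sh T) = (\<lambda>i. below T i n)" if "T \<in> ?X" for T
    unfolding sh_def
  proof (rule part_Abs)
    have T: "T \<in> ssyt (part a)" using that by simp
    show "below T (Suc i) n \<le> below T i n" for i
      using below_interlace[OF T, of i n] below_mono[of n "Suc n" T "Suc i"] by simp
    show "below T i n \<le> part a i" for i by (rule below_le)
  qed
  have in_sh: "p \<in> ?D (sh T) \<longleftrightarrow> p \<in> ?D a \<and> T p < n" if T: "T \<in> ?X" for T p
  proof -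
    obtain i j where p: "p = (i, j)" by force
    have "j < below T i n \<longleftrightarrow> j < part a i \<and> T (i, j) < n"
      using below_iff[of T j i n] T below_le[of T i n] by auto
    then show ?thesis by (simp add: p diagram_def part_sh[OF T])
  qed
  have g_in: "g T \<in> Sigma ?B ?Y" if T: "T \<in> ?X" for T
  proof -
    have Ts: "T \<in> ssyt (part a)" using T by simp
    have "hstrip a (sh T)"
      unfolding hstrip_def part_sh[OF T]
    proof (intro allI conjI)
      fix i
      show "below T i n \<le> part a i" by (rule below_le)
      \<comment> \<open>No entry exceeds \<open>n\<close>, so the count below \<open>Suc n\<close>
        is the whole row and \<open>below_interlace\<close> becomes the strip condition.\<close>
      have "below T (Suc i) (Suc n) = part a (Suc i)"
      proof (rule belowI)
        fix j assume "j < part a (Suc i)"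
        then show "T (Suc i, j) < Suc n \<longleftrightarrow> j < part a (Suc i)"
          using T_le[OF T, of "(Suc i, j)"] by (simp add: diagram_def less_Suc_eq_le)
      qed simp
      then show "part a (Suc i) \<le> below T i n" using below_interlace[OF Ts, of i n] by simp
    qed
    moreover have c: "tableau_content (part (sh T)) (restrict T (?D (sh T))) = m"
    proof -
      have D: "?D (sh T) = {p \<in> ?D a. T p < n}" using in_sh[OF T] by auto
      have "tableau_content (part (sh T)) (restrict T (?D (sh T))) = image_mset T (mset_set {p \<in> ?D a. T p < n})"
      unfolding tableau_content_def D
      by (rule image_mset_cong) (simp add: finite_diagram_part)
    also have "\<dots> = filter_mset (\<lambda>x. x < n) (tableau_content (part a) T)"
      by (simp add: tableau_content_def filter_mset_image_mset filter_mset_mset_set finite_diagram_part)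
    also have "\<dots> = m" unfolding filter_mset_eq_conv using T n by (auto split: if_splits)
    finally show ?thesis .
    qed
    moreover have "psize (sh T) + k = psize a"
    proof -
      have "psize (sh T) = size m" using arg_cong[OF c, of size] by (simp add: tableau_content_def psize_def)
      moreover have "psize a = size (tableau_content (part a) T)"
        by (simp add: tableau_content_def psize_def)
      ultimately show ?thesis using T by simp
    qed
    moreover have "restrict T (?D (sh T)) \<in> ssyt (part (sh T))"
      unfolding ssyt_def
    proof (intro CollectI conjI allI impI)
      fix i j assume ij: "(i, Suc j) \<in> ?D (sh T)"
      then have "(i, j) \<in> ?D (sh T)" by (simp add: diagram_def)
      with ij in_sh[OF T] Ts show "restrict T (?D (sh T)) (i, j) \<le> restrict T (?D (sh T)) (i, Suc j)"
        by (simp add: ssyt_def)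
    next
      fix i j assume ij: "(Suc i, j) \<in> ?D (sh T)"
      then have "(i, j) \<in> ?D (sh T)"
        using part_antimono[of i "Suc i" "sh T"] by (simp add: diagram_def)
      with ij in_sh[OF T] Ts show "restrict T (?D (sh T)) (i, j) < restrict T (?D (sh T)) (Suc i, j)"
        by (simp add: ssyt_def)
    qed simp
    ultimately show ?thesis by (simp add: g_def)
  qed
  have "bij_betw g ?X (Sigma ?B ?Y)"
  proof (rule bij_betw_byWitness[where f' = f])
    show "\<forall>T\<in>?X. f (g T) = T"
    proof
      fix T assume T: "T \<in> ?X"
      show "f (g T) = T"
      proof
        fix p
        have "T \<in> extensional (?D a)" using T by (simp add: ssyt_def)
        then have "T p = undefined" if "p \<notin> ?D a" using that by (rule extensional_arb)
        then show "f (g T) p = T p"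
          using in_sh[OF T, of p] T_le[OF T, of p] by (auto simp: f_def g_def)
      qed
    qed
    show "\<forall>z\<in>Sigma ?B ?Y. g (f z) = z"
    proof clarify
      fix b T assume b: "hstrip a b" "psize b + k = psize a"
        and T: "T \<in> ssyt (part b)" "m = tableau_content (part b) T"
      have fX: "f (b, T) \<in> ?X" using f_in b T by blast
      have TY: "T \<in> ?Y b" using T by simp
      have sub: "?D b \<subseteq> ?D a" using b by (intro diagram_mono) (simp add: hstrip_def)
      have "p \<in> ?D (sh (f (b, T))) \<longleftrightarrow> p \<in> ?D b" for p
        using in_sh[OF fX, of p] T_less[OF TY, of p] sub by (auto simp: f_def)
      then have D: "?D (sh (f (b, T))) = ?D b" by blast
      have "part (sh (f (b, T))) i = part b i" for i
      proof -
        have "{j. (i, j) \<in> ?D (sh (f (b, T)))} = {j. (i, j) \<in> ?D b}" using D by simp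
        then show ?thesis by (simp add: diagram_def flip: lessThan_def)
      qed
      then have "sh (f (b, T)) = b" by (rule part_eqI)
      moreover have "restrict (f (b, T)) (?D b) = T"
        using T by (auto simp: f_def ssyt_def extensional_def fun_eq_iff)
      ultimately show "g (f (b, T)) = (b, T)" by (simp add: g_def)
    qed
    show "f ` Sigma ?B ?Y \<subseteq> ?X"
    proof (rule image_subsetI)
      fix z assume "z \<in> Sigma ?B ?Y"
      then obtain b T where "z = (b, T)" "b \<in> ?B" "T \<in> ?Y b" by blast
      then show "f z \<in> ?X" using f_in by (simp only:)
    qed
    show "g ` ?X \<subseteq> Sigma ?B ?Y" using g_in by (rule image_subsetI)
  qed
  then have "card ?X = card (Sigma ?B ?Y)" by (rule bij_betw_same_card)
  also have "\<dots> = (\<Sum>b\<in>?B. card (?Y b))"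
    by (rule card_SigmaI) (auto simp: finite_hstrip finite_ssyt_content)
  finally show ?thesis .
qed

text \<open>A variable above all those in \<open>m\<close> is fresh, so it may be extracted, and as
  the largest entry it is governed by the branching rule.\<close>

lemma skew_h_schur: "skew_h k (schur a) = (\<Sum>b | hstrip a b \<and> psize b + k = psize a. schur b)"
proof (rule symfun_eqI)
  fix m :: "nat multiset"
  obtain n where n: "\<And>x. x \<in># m \<Longrightarrow> x < n"
    using finite_nat_set_iff_bounded[of "set_mset m"] by auto
  then have "symfun_coeff (skew_h k (schur a)) m = symfun_coeff (schur a) (replicate_mset k n + m)"
    by (intro coeff_skew_h_fresh) blast
  then show "symfun_coeff (skew_h k (schur a)) m
      = symfun_coeff (\<Sum>b | hstrip a b \<and> psize b + k = psize a. schur b) m"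
    using card_ssyt_branching[OF n, where a = a and k = k]
    by (simp add: schur.rep_eq schur_series_def coeff_sum)
qed


section \<open>Vertical strips\<close>

lemma psize_mono:
  assumes "\<And>i. part b i \<le> part a i"
  shows "psize b \<le> psize a"
  unfolding psize_def by (rule card_mono[OF finite_diagram_part diagram_mono]) (rule assms)

lemma psize_mono_eq:
  assumes "\<And>i. part b i \<le> part a i" "psize b = psize a"
  shows "b = a"
proof (rule part_eqI)
  fix i
  have "diagram (part b) = diagram (part a)"
    using assms(2) unfolding psize_def
    by (intro card_subset_eq[OF finite_diagram_part diagram_mono]) (rule assms(1))
  then have "{j. (i, j) \<in> diagram (part b)} = {j. (i, j) \<in> diagram (part a)}" by simp
  then show "part b i = part a i" by (simp add: diagram_def flip: lessThan_def)
qed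

section \<open>First rows, first columns and extremal strips\<close>

definition plen :: "partition \<Rightarrow> nat" where
  "plen a = (LEAST i. part a i = 0)"

lemma part_eq_0_iff: "part a i = 0 \<longleftrightarrow> plen a \<le> i"
proof
  show "part a i = 0 \<Longrightarrow> plen a \<le> i" unfolding plen_def by (rule Least_le)
  obtain N where "part a N = 0" using part_eventually_zero[of a] by blast
  then have "part a (plen a) = 0" unfolding plen_def by (rule LeastI)
  then show "plen a \<le> i \<Longrightarrow> part a i = 0" using part_antimono[of "plen a" i a] by simp
qed

lift_definition tail_part :: "partition \<Rightarrow> partition" is "\<lambda>l i. l (Suc i)"
proof
  fix l :: "nat \<Rightarrow> nat"
  assume l: "antimono l \<and> finite {i. l i \<noteq> 0}"
  then show "antimono (\<lambda>i. l (Suc i))" by (simp add: antimono_def)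
  have "finite (Suc -` {i. l i \<noteq> 0})" by (rule finite_vimageI) (use l in auto)
  then show "finite {i. l (Suc i) \<noteq> 0}" by (simp add: vimage_def)
qed

lift_definition drop_column :: "partition \<Rightarrow> partition" is "\<lambda>l i. l i - 1"
proof
  fix l :: "nat \<Rightarrow> nat"
  assume l: "antimono l \<and> finite {i. l i \<noteq> 0}"
  then show "antimono (\<lambda>i. l i - 1)" by (simp add: antimono_def diff_le_mono)
  show "finite {i. l i - 1 \<noteq> 0}" by (rule finite_subset[of _ "{i. l i \<noteq> 0}"]) (use l in auto)
qed

lemmas part_tail = tail_part.rep_eq and part_drop_column = drop_column.rep_eq

lemma psize_tail: "psize a = part a 0 + psize (tail_part a)"
proof -
  have "psize a = (\<Sum>i<Suc (plen a). part a i)" by (rule psize_sum) (simp add: part_eq_0_iff)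
  moreover have "psize (tail_part a) = (\<Sum>i<plen a. part (tail_part a) i)"
    by (rule psize_sum) (simp add: part_tail part_eq_0_iff)
  ultimately show ?thesis by (simp add: sum.lessThan_Suc_shift part_tail del: sum.lessThan_Suc)
qed

lemma psize_drop_column: "psize a = psize (drop_column a) + plen a"
proof -
  have "psize a = (\<Sum>i<plen a. part a i)" by (rule psize_sum) (simp add: part_eq_0_iff)
  also have "\<dots> = (\<Sum>i<plen a. part (drop_column a) i + 1)"
  proof (rule sum.cong)
    fix i assume "i \<in> {..<plen a}"
    then have "part a i \<noteq> 0" by (simp add: part_eq_0_iff)
    then show "part a i = part (drop_column a) i + 1" by (simp add: part_drop_column)
  qed simp
  also have "\<dots> = (\<Sum>i<plen a. part (drop_column a) i) + plen a" by (simp add: sum_Suc)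
  also have "(\<Sum>i<plen a. part (drop_column a) i) = psize (drop_column a)"
    by (rule psize_sum[symmetric]) (use part_eq_0_iff[of a "plen a"] in \<open>simp add: part_drop_column\<close>)
  finally show ?thesis .
qed

text \<open>Interlacing forces \<open>b\<close> to contain \<open>tail_part a\<close>. So the tail
  is the smallest possible \<open>b\<close> and, by size, the only one that attains the
  bound.\<close>

lemma hstrip_psize: "hstrip a b \<Longrightarrow> psize a \<le> psize b + part a 0"
  using psize_mono[of "tail_part a" b] psize_tail[of a] by (simp add: hstrip_def part_tail)

lemma hstrip_psize_eq: "hstrip a b \<Longrightarrow> psize a = psize b + part a 0 \<Longrightarrow> b = tail_part a"
  using psize_mono_eq[of "tail_part a" b] psize_tail[of a] by (simp add: hstrip_def part_tail)

lemma hstrip_tail: "hstrip a (tail_part a)"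
  using part_antimono[of _ _ a] by (simp add: hstrip_def part_tail)

text \<open>Here \<open>drop_column a\<close> is the smallest possible \<open>b\<close>, with the
  same consequence for the extremal case.\<close>

lemma vstrip_psize: "vstrip a b \<Longrightarrow> psize a \<le> psize b + plen a"
proof -
  assume "vstrip a b"
  then have "part (drop_column a) i \<le> part b i" for i
    unfolding vstrip_def by (simp add: part_drop_column le_diff_conv)
  then show ?thesis using psize_mono[of "drop_column a" b] psize_drop_column[of a] by simp
qed

lemma vstrip_psize_eq: "vstrip a b \<Longrightarrow> psize a = psize b + plen a \<Longrightarrow> b = drop_column a"
proof -
  assume "vstrip a b" and eq: "psize a = psize b + plen a"
  then have "part (drop_column a) i \<le> part b i" for i
    unfolding vstrip_def by (simp add: part_drop_column le_diff_conv)
  then show ?thesis using psize_mono_eq[of "drop_column a" b] psize_drop_column[of a] eq by simp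
qed

lemma skew_h_schur_top: "skew_h (part a 0) (schur a) = schur (tail_part a)"
proof -
  have "{b. hstrip a b \<and> psize b + part a 0 = psize a} = {tail_part a}"
    using hstrip_psize_eq[of a] hstrip_tail[of a] psize_tail[of a] by auto
  then show ?thesis by (simp add: skew_h_schur)
qed

lemma skew_h_schur_eq_0:
  assumes "part a 0 < k"
  shows "skew_h k (schur a) = 0"
proof -
  have "{b. hstrip a b \<and> psize b + k = psize a} = {}"
    using hstrip_psize[of a] assms by fastforce
  then show ?thesis unfolding skew_h_schur by (simp only: sum.empty)
qed

text \<open>These pairs index the terms of \<open>h_i^perp e_j^perp s_a\<close> with
  \<open>i + j = m\<close>.\<close>

definition strip_pairs :: "partition \<Rightarrow> nat \<Rightarrow> (partition \<times> partition) set" where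
  "strip_pairs a m = {(b, c). vstrip a b \<and> hstrip b c \<and> psize c + m = psize a}"

lemma strip_pairs_psize:
  assumes "(b, c) \<in> strip_pairs a m"
  shows "psize c \<le> psize b" "psize b \<le> psize a" "psize c + m = psize a"
  using assms by (auto simp: strip_pairs_def vstrip_def hstrip_def intro: psize_mono)

lemma skew_h_sign: "skew_h i ((- 1) ^ k * f) = (- 1) ^ k * skew_h i f"
  by (cases "even k") (simp_all add: skew_h_uminus)

text \<open>The sizes of \<open>b\<close> and \<open>c\<close> determine the two strip lengths, so
  the summation over these lengths disappears. The weight stays general to serve both
  \<open>H(t)\<close> and \<open>t H'(t)\<close>.\<close>

lemma skew_fps_vstrips:
  "skew_fps w (Abs_fps (\<lambda>j. (- 1) ^ j * (\<Sum>b | vstrip a b \<and> psize b + j = psize a. schur b))) $ m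
    = (\<Sum>(b, c)\<in>strip_pairs a m. w (psize b - psize c) * (- 1) ^ (psize a - psize b) * schur c)"
proof -
  let ?V = "\<lambda>j. {b. vstrip a b \<and> psize b + j = psize a}"
  let ?H = "\<lambda>b i. {c. hstrip b c \<and> psize c + i = psize b}"
  have "skew_fps w (Abs_fps (\<lambda>j. (- 1) ^ j * (\<Sum>b\<in>?V j. schur b))) $ m
      = (\<Sum>i\<le>m. \<Sum>b\<in>?V (m - i). \<Sum>c\<in>?H b i. w i * (- 1) ^ (m - i) * schur c)"
    by (simp add: skew_fps_def skew_h_sign skew_h_sum skew_h_schur sum_distrib_left mult.assoc)
  also have "\<dots> = (\<Sum>i\<le>m. \<Sum>(b, c) \<in> (SIGMA b:?V (m - i). ?H b i). w i * (- 1) ^ (m - i) * schur c)"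
    by (intro sum.cong refl sum.Sigma) (auto simp: finite_vstrip finite_hstrip)
  also have "\<dots> = (\<Sum>(i, b, c) \<in> (SIGMA i:{..m}. SIGMA b:?V (m - i). ?H b i).
      w i * (- 1) ^ (m - i) * schur c)"
    by (rule sum.Sigma) (auto simp: finite_vstrip finite_hstrip)
  also have "\<dots> = (\<Sum>(b, c)\<in>strip_pairs a m. w (psize b - psize c) * (- 1) ^ (psize a - psize b) * schur c)"
  proof (rule sum.reindex_bij_witness[where i = "\<lambda>(b, c). (psize b - psize c, b, c)" and j = "\<lambda>(i, b, c). (b, c)"])
    fix z assume "z \<in> strip_pairs a m"
    moreover obtain b c where "z = (b, c)" by force
    ultimately show "(case z of (b, c) \<Rightarrow> (psize b - psize c, b, c)) \<in> (SIGMA i:{..m}. SIGMA b:?V (m - i). ?H b i)"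
      using strip_pairs_psize[of b c a m] by (auto simp: strip_pairs_def)
  next
    fix z assume "z \<in> (SIGMA i:{..m}. SIGMA b:?V (m - i). ?H b i)"
    then obtain i b c where z: "z = (i, b, c)" "i \<le> m" "vstrip a b" "psize b + (m - i) = psize a"
      "hstrip b c" "psize c + i = psize b" by auto
    then have "psize b - psize c = i" "psize a - psize b = m - i" by linarith+
    then show "(case case z of (i, b, c) \<Rightarrow> (b, c) of (b, c) \<Rightarrow> w (psize b - psize c) * (- 1) ^ (psize a - psize b) * schur c)
        = (case z of (i, b, c) \<Rightarrow> w i * (- 1) ^ (m - i) * schur c)"
      by (simp add: z)
  qed (auto simp: strip_pairs_def)
  finally show ?thesis .
qed

lemma part_between:
  assumes "\<And>i. part c i \<le> f i" "\<And>i. f (Suc i) \<le> part c i" "\<And>i. f i \<le> part a i"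
  shows "part (Abs_partition f) = f"
proof (rule part_Abs)
  show "f (Suc i) \<le> f i" for i using assms(1,2)[of i] by (rule le_trans[rotated])
qed (rule assms(3))

text \<open>
  In the first row where \<open>a\<close> and \<open>c\<close> differ, \<open>b\<close> may contain the last box of \<open>a\<close> or not,
  independently of the other rows.
\<close>

lemma sum_strip_pairs_sign:
  assumes "0 < m"
  shows "(\<Sum>(b, c)\<in>strip_pairs a m. (- 1) ^ (psize a - psize b) * schur c) = 0"
proof -
  define r where "r c = (LEAST i. part c i \<noteq> part a i)" for c
  let ?up = "{(b, c) \<in> strip_pairs a m. part b (r c) = part a (r c)}"
  let ?down = "{(b, c) \<in> strip_pairs a m. part b (r c) \<noteq> part a (r c)}"
  let ?g = "\<lambda>(b, c). (- 1) ^ (psize a - psize b) * schur c"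
  \<comment> \<open>Passing between the lengths \<open>part a (r c)\<close> and
    \<open>part a (r c) - 1\<close> in this row is the sign-reversing involution.\<close>
  define put where "put x c b = Abs_partition ((part b)(r c := x))" for x c b
  have fin: "finite (strip_pairs a m)"
  proof (rule finite_subset)
    show "strip_pairs a m \<subseteq> {b. \<forall>i. part b i \<le> part a i} \<times> {b. \<forall>i. part b i \<le> part a i}"
      unfolding strip_pairs_def vstrip_def hstrip_def using le_trans by blast
  qed (simp add: finite_smaller_partitions)
  have main: "part c (r c) < part a (r c)" "x \<in> {part a (r c) - 1, part a (r c)} \<Longrightarrow>
      part (put x c b) = (part b)(r c := x) \<and> (put x c b, c) \<in> strip_pairs a m \<and>
      psize (put x c b) + part b (r c) = psize b + x"
    if bc: "(b, c) \<in> strip_pairs a m" for b c x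
  proof -
    have b: "\<And>i. part b i \<le> part a i" "\<And>i. part a i \<le> Suc (part b i)"
      and c: "\<And>i. part c i \<le> part b i" "\<And>i. part b (Suc i) \<le> part c i"
      using bc by (auto simp: strip_pairs_def vstrip_def hstrip_def)
    have "c \<noteq> a" using bc assms by (auto simp: strip_pairs_def)
    then have "\<exists>i. part c i \<noteq> part a i" using part_eqI by blast
    then have rc: "part c (r c) \<noteq> part a (r c)" unfolding r_def by (rule LeastI_ex)
    have before: "part c i = part a i" if "i < r c" for i
      using not_less_Least[OF that[unfolded r_def]] by simp
    show lt: "part c (r c) < part a (r c)"
      using rc b(1)[of "r c"] c(1)[of "r c"] by simp
    assume x: "x \<in> {part a (r c) - 1, part a (r c)}"
    let ?f = "(part b)(r c := x)"
    have f: "part c i \<le> ?f i" "?f i \<le> part a i" "part a i \<le> Suc (?f i)" for i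
      using b[of i] c(1)[of i] lt x by auto
    \<comment> \<open>The choice of the first differing row enters here: the row of \<open>c\<close>
      above it agrees with that of \<open>a\<close>, so it is long enough for both values of
      \<open>x\<close>.\<close>
    have f_Suc: "?f (Suc i) \<le> part c i" for i
    proof (cases "Suc i = r c")
      case True
      have "part a (r c) \<le> part a i" by (rule part_antimono) (use True in simp)
      then show ?thesis using x True before[of i] by auto
    next
      case False
      then show ?thesis using c(2) by simp
    qed
    have pt: "part (put x c b) = ?f"
      unfolding put_def by (rule part_between[OF f(1) f_Suc f(2)])
    moreover have "psize (put x c b) + part b (r c) = psize b + x"
    proof -
      have z: "part a (plen a) = 0" by (simp add: part_eq_0_iff)
      have r: "r c < plen a" using lt part_eq_0_iff[of a "r c"] by simp
      have "psize (put x c b) = (\<Sum>i<plen a. ?f i)"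
        unfolding pt[symmetric] by (rule psize_sum) (use pt f(2)[of "plen a"] z in simp)
      also have "\<dots> = x + (\<Sum>i\<in>{..<plen a} - {r c}. part b i)"
        using r by (simp add: sum.remove[of _ "r c"] del: sum.lessThan_Suc)
      moreover have "psize b = part b (r c) + (\<Sum>i\<in>{..<plen a} - {r c}. part b i)"
        using psize_sum[of b "plen a"] b(1)[of "plen a"] z r
        by (simp add: sum.remove[of _ "r c"] del: sum.lessThan_Suc)
      ultimately show ?thesis by simp
    qed
    moreover have "(put x c b, c) \<in> strip_pairs a m"
    proof -
      have "vstrip a (put x c b)" unfolding vstrip_def pt using f(2,3) by blast
      moreover have "hstrip (put x c b) c" unfolding hstrip_def pt using f(1) f_Suc by blast
      ultimately show ?thesis using bc by (simp add: strip_pairs_def)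
    qed
    ultimately show "part (put x c b) = ?f \<and> (put x c b, c) \<in> strip_pairs a m \<and>
        psize (put x c b) + part b (r c) = psize b + x" by blast
  qed
  have down: "part b (r c) = part a (r c) - 1" if "(b, c) \<in> ?down" for b c
  proof -
    have "part b (r c) \<le> part a (r c)" "part a (r c) \<le> Suc (part b (r c))"
      using that by (auto simp: strip_pairs_def vstrip_def)
    moreover have "part b (r c) \<noteq> part a (r c)" using that by simp
    ultimately show ?thesis by linarith
  qed
  have put_put: "put x c b' = b" if "part b' = (part b)(r c := y)" "part b (r c) = x" for x y b b' c
    unfolding put_def that(1) using that(2) by (simp add: fun_upd_idem part_inverse)
  have "sum ?g ?down = (\<Sum>z\<in>?up. - ?g z)"
  proof (rule sum.reindex_bij_witness[where
        i = "\<lambda>(b, c). (put (part a (r c) - 1) c b, c)" and j = "\<lambda>(b, c). (put (part a (r c)) c b, c)"])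
    fix z assume z: "z \<in> ?down"
    obtain b c where bc: "z = (b, c)" by force
    have P: "(b, c) \<in> strip_pairs a m" using z bc by simp
    note m = main(1)[OF P] main(2)[OF P, of "part a (r c)", simplified]
    have d: "part b (r c) = part a (r c) - 1" using down z bc by blast
    show "(case case z of (b, c) \<Rightarrow> (put (part a (r c)) c b, c) of (b, c) \<Rightarrow> (put (part a (r c) - 1) c b, c)) = z"
      using m d put_put[of "put (part a (r c)) c b" b c] by (simp add: bc)
    show "(case z of (b, c) \<Rightarrow> (put (part a (r c)) c b, c)) \<in> ?up"
      using m by (simp add: bc)
    \<comment> \<open>The restored box changes the size of \<open>b\<close> by one, which reverses
      the sign.\<close>
    have "psize a - psize b = Suc (psize a - psize (put (part a (r c)) c b))"
      using m d strip_pairs_psize[of "put (part a (r c)) c b" c a m] by linarith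
    then show "- ?g (case z of (b, c) \<Rightarrow> (put (part a (r c)) c b, c)) = ?g z"
      by (simp add: bc)
  next
    fix z assume z: "z \<in> ?up"
    obtain b c where bc: "z = (b, c)" by force
    have P: "(b, c) \<in> strip_pairs a m" using z bc by simp
    note m = main(1)[OF P] main(2)[OF P, of "part a (r c) - 1", simplified]
    have d: "part b (r c) = part a (r c)" using z bc by simp
    show "(case case z of (b, c) \<Rightarrow> (put (part a (r c) - 1) c b, c) of (b, c) \<Rightarrow> (put (part a (r c)) c b, c)) = z"
      using m d put_put[of "put (part a (r c) - 1) c b" b c] by (simp add: bc)
    show "(case z of (b, c) \<Rightarrow> (put (part a (r c) - 1) c b, c)) \<in> ?down"
      using m by (simp add: bc)
  qed
  then have "sum ?g ?down = - sum ?g ?up" by (simp add: sum_negf)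
  moreover have "sum ?g (strip_pairs a m) = sum ?g ?up + sum ?g ?down"
  proof -
    have fin': "finite ?up" "finite ?down" by (rule finite_subset[OF _ fin], blast)+
    have "?up \<inter> ?down = {}" "?up \<union> ?down = strip_pairs a m" by blast+
    then show ?thesis using sum.union_disjoint[OF fin', of ?g] by (simp only:)
  qed
  ultimately show ?thesis by simp
qed

lemma strip_pairs_0: "strip_pairs a 0 = {(a, a)}"
proof -
  have "b = a \<and> c = a" if "(b, c) \<in> strip_pairs a 0" for b c
  proof -
    have "b = a"
      using that strip_pairs_psize[OF that]
      by (intro psize_mono_eq) (auto simp: strip_pairs_def vstrip_def)
    moreover have "c = b"
      using that strip_pairs_psize[OF that] calculation
      by (intro psize_mono_eq) (auto simp: strip_pairs_def hstrip_def)
    ultimately show ?thesis by simp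
  qed
  moreover have "(a, a) \<in> strip_pairs a 0"
    using part_antimono[of _ _ a] by (simp add: strip_pairs_def vstrip_def hstrip_def)
  ultimately show ?thesis by auto
qed

text \<open>The dual Pieri rule for \<open>e_j^perp\<close> is verified by uniqueness: applying the
  adjoint of \<open>H(t)\<close> to the claimed series gives signed sums over strip pairs, which
  cancel except for the pair \<open>(a, a)\<close>.\<close>

lemma skew_e_schur:
  "skew_e (schur a) = Abs_fps (\<lambda>j. (- 1) ^ j * (\<Sum>b | vstrip a b \<and> psize b + j = psize a. schur b))"
proof (rule skew_e_unique, rule fps_ext)
  fix m
  show "skew_all (Abs_fps (\<lambda>j. (- 1) ^ j * (\<Sum>b | vstrip a b \<and> psize b + j = psize a. schur b))) $ m
      = fps_const (schur a) $ m"
    unfolding skew_fps_vstrips using sum_strip_pairs_sign[of m a]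
    by (cases "m = 0") (simp_all add: strip_pairs_0)
qed


section \<open>Principal hooks and leading monomials\<close>

text \<open>The number of boxes in the first row and the first column together; truncated
  subtraction makes it 0 for the empty partition.\<close>

definition hook :: "partition \<Rightarrow> nat" where
  "hook a = part a 0 + plen a - 1"

definition inner_part :: "partition \<Rightarrow> partition" where
  "inner_part a = drop_column (tail_part a)"

lemma part_inner: "part (inner_part a) i = part a (Suc i) - 1"
  by (simp add: inner_part_def part_tail part_drop_column)

lemma plen_tail: "plen (tail_part a) = plen a - 1"
proof -
  have "plen (tail_part a) \<le> i \<longleftrightarrow> plen a - 1 \<le> i" for i
    using part_eq_0_iff[of "tail_part a" i] part_eq_0_iff[of a "Suc i"] by (auto simp: part_tail)
  then show ?thesis by (metis le_antisym order_refl)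
qed

lemma tail_drop_column: "tail_part (drop_column a) = inner_part a"
  by (rule part_eqI) (simp add: part_inner part_tail part_drop_column)

text \<open>If the first row survives the vertical strip, this strip has at most
  \<open>plen a - 1\<close> boxes and the horizontal one at most \<open>part a 0\<close>; otherwise
  the bounds are \<open>plen a\<close> and \<open>part a 0 - 1\<close>. Both add up to the hook
  length, so \<open>hook a \<le> m\<close> forces equality and both strips are extremal.\<close>

lemma strip_pairs_hook:
  assumes bc: "(b, c) \<in> strip_pairs a m" and m: "0 < m" "hook a \<le> m"
  shows "m = hook a" "c = inner_part a"
    "b = drop_column a \<or> part b 0 = part a 0 \<and> tail_part b = inner_part a"
proof -
  have v: "vstrip a b" and h: "hstrip b c" and sz: "psize c + m = psize a"
    using bc by (auto simp: strip_pairs_def)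
  have "part a 0 \<noteq> 0"
  proof
    assume "part a 0 = 0"
    then have "part a i = 0" for i using part_antimono[of 0 i a] by simp
    then have "psize a = 0" using psize_sum[of a 0] by simp
    with sz m show False by simp
  qed
  then have a0: "part a 0 > 0" "plen a > 0" using part_eq_0_iff[of a 0] by auto
  have "part b 0 \<le> part a 0" "part a 0 \<le> Suc (part b 0)" using v by (auto simp: vstrip_def)
  then consider "part b 0 = part a 0" | "Suc (part b 0) = part a 0" by linarith
  then have "m = hook a \<and> c = inner_part a \<and>
      (b = drop_column a \<or> part b 0 = part a 0 \<and> tail_part b = inner_part a)"
  proof cases
    case 1
    have vt: "vstrip (tail_part a) (tail_part b)" using v by (simp add: vstrip_def part_tail)
    have t: "psize (tail_part a) \<le> psize (tail_part b) + (plen a - 1)"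
      using vstrip_psize[OF vt] by (simp add: plen_tail)
    have "psize c + m \<le> part a 0 + psize (tail_part b) + (plen a - 1)"
      using sz psize_tail[of a] t by simp
    moreover have "psize (tail_part b) \<le> psize c" using hstrip_psize[OF h] psize_tail[of b] by simp
    ultimately have "m = hook a" "psize c = psize (tail_part b)"
      "psize (tail_part a) = psize (tail_part b) + (plen a - 1)"
      using m a0 sz psize_tail[of a] t unfolding hook_def by linarith+
    moreover from this have "tail_part b = inner_part a"
      using vstrip_psize_eq[OF vt] by (simp add: plen_tail inner_part_def)
    moreover have "c = tail_part b"
      using hstrip_psize_eq[OF h] psize_tail[of b] calculation by simp
    ultimately show ?thesis using 1 by simp
  next
    case 2
    have "psize a \<le> psize b + plen a" by (rule vstrip_psize[OF v])
    moreover have "psize b \<le> psize c + part b 0" by (rule hstrip_psize[OF h])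
    ultimately have "m = hook a" "psize a = psize b + plen a" "psize b = psize c + part b 0"
      using m a0 sz 2 unfolding hook_def by linarith+
    then show ?thesis
      using vstrip_psize_eq[OF v] hstrip_psize_eq[OF h] by (simp add: tail_drop_column)
  qed
  then show "m = hook a" "c = inner_part a"
    "b = drop_column a \<or> part b 0 = part a 0 \<and> tail_part b = inner_part a" by auto
qed

lemma skew_p_schur: "skew_p m (schur a)
    = (\<Sum>(b, c)\<in>strip_pairs a m. of_nat (psize b - psize c) * (- 1) ^ (psize a - psize b) * schur c)"
  unfolding skew_p_def skew_e_schur by (rule skew_fps_vstrips)

lemma skew_p_schur_eq_0:
  assumes "0 < m" "hook a < m"
  shows "skew_p m (schur a) = 0"
proof -
  have "strip_pairs a m = {}" using strip_pairs_hook(1)[of _ _ a m] assms by fastforce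
  then show ?thesis unfolding skew_p_schur by (simp only: sum.empty)
qed

text \<open>
  The hook is cut off either by removing the first column and then the rest of the first row, or by
  removing the first column without its top box and then the whole first row.  The two terms carry
  opposite signs and the multiplicities \<open>part a 0 - 1\<close> and \<open>part a 0\<close>.
\<close>

lemma skew_p_schur_hook:
  assumes "0 < hook a"
  shows "skew_p (hook a) (schur a) = (- 1) ^ (plen a - 1) * schur (inner_part a)"
proof -
  have a0: "part a 0 > 0" "plen a > 0"
    using assms part_eq_0_iff[of a 0] part_eq_0_iff[of a "plen a"] by (auto simp: hook_def gr0_conv_Suc)
  define b where "b = Abs_partition (\<lambda>i. if i = 0 then part a 0 else part a i - 1)"
  have b: "part b = (\<lambda>i. if i = 0 then part a 0 else part a i - 1)"
    unfolding b_def
  proof (rule part_Abs[where a = a])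
    fix i
    show "(if Suc i = 0 then part a 0 else part a (Suc i) - 1) \<le> (if i = 0 then part a 0 else part a i - 1)"
      using part_antimono[of i "Suc i" a] by auto
  qed simp
  have tb: "tail_part b = inner_part a"
    by (rule part_eqI) (simp add: part_inner part_tail b)
  have sb: "psize b = part a 0 + psize (inner_part a)" using psize_tail[of b] by (simp add: tb b)
  have sd: "psize (drop_column a) = part a 0 - 1 + psize (inner_part a)"
    using psize_tail[of "drop_column a"] by (simp add: tail_drop_column part_drop_column)
  have sa: "psize a = part a 0 - 1 + psize (inner_part a) + plen a"
    using psize_drop_column[of a] by (simp add: sd)
  have ne: "b \<noteq> drop_column a" using sb sd a0 by auto
  have "strip_pairs a (hook a) = {(b, inner_part a), (drop_column a, inner_part a)}"
  proof
    show "strip_pairs a (hook a) \<subseteq> {(b, inner_part a), (drop_column a, inner_part a)}"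
    proof (rule subsetI)
      fix z assume "z \<in> strip_pairs a (hook a)"
      moreover obtain b' c where z: "z = (b', c)" by force
      ultimately have bc: "(b', c) \<in> strip_pairs a (hook a)" by simp
      note hk = strip_pairs_hook[OF bc assms order_refl]
      show "z \<in> {(b, inner_part a), (drop_column a, inner_part a)}"
      proof (cases "b' = drop_column a")
        case False
        then have "part b' 0 = part a 0" "tail_part b' = inner_part a" using hk by auto
        then have zero: "part b' 0 = part b 0" and "tail_part b' = tail_part b" by (simp_all add: tb b)
        then have "part (tail_part b') j = part (tail_part b) j" for j by simp
        then have "part b' (Suc j) = part b (Suc j)" for j by (simp only: part_tail)
        then have "part b' i = part b i" for i using zero by (cases i) simp_all
        then have "b' = b" by (rule part_eqI)
        with hk z show ?thesis by simp
      qed (use hk z in simp)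
    qed
    have "vstrip a b" "vstrip a (drop_column a)" by (auto simp: vstrip_def b part_drop_column)
    moreover have "hstrip b (inner_part a)" "hstrip (drop_column a) (inner_part a)"
      using hstrip_tail[of b] hstrip_tail[of "drop_column a"] by (simp_all add: tb tail_drop_column)
    moreover have "psize (inner_part a) + hook a = psize a" using sa a0 by (simp add: hook_def)
    ultimately show "{(b, inner_part a), (drop_column a, inner_part a)} \<subseteq> strip_pairs a (hook a)"
      by (auto simp: strip_pairs_def)
  qed
  moreover have "psize b - psize (inner_part a) = part a 0"
    "psize (drop_column a) - psize (inner_part a) = part a 0 - 1"
    "psize a - psize b = plen a - 1" "psize a - psize (drop_column a) = plen a"
    using sa sb sd a0 by linarith+
  \<comment> \<open>The difference of the two multiplicities is 1, so only a sign remains as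
    coefficient.\<close>
  ultimately have "skew_p (hook a) (schur a)
      = of_nat (part a 0) * (- 1) ^ (plen a - 1) * schur (inner_part a)
        + of_nat (part a 0 - 1) * (- 1) ^ plen a * schur (inner_part a)"
    using ne by (simp add: skew_p_schur)
  also have "(- 1) ^ plen a = - ((- 1) ^ (plen a - 1) :: symfun)"
    using a0 by (cases "plen a") simp_all
  also have "of_nat (part a 0) = (of_nat (part a 0 - 1) + 1 :: symfun)"
    using a0 by (cases "part a 0") simp_all
  finally show ?thesis by (simp add: algebra_simps)
qed

section \<open>Lexicographic order and leading monomials\<close>

definition lexless :: "nat multiset \<Rightarrow> nat multiset \<Rightarrow> bool" where
  "lexless m n \<longleftrightarrow> (\<exists>i. (\<forall>j<i. count m j = count n j) \<and> count m i < count n i)"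

lemma lexless_linear: "lexless m n \<or> m = n \<or> lexless n m"
proof (cases "m = n")
  case False
  then have ex: "\<exists>i. count m i \<noteq> count n i" by (auto simp: multiset_eq_iff)
  define i where "i = (LEAST i. count m i \<noteq> count n i)"
  have "count m i \<noteq> count n i" unfolding i_def using ex by (rule LeastI_ex)
  moreover have "count m j = count n j" if "j < i" for j
    using not_less_Least[OF that[unfolded i_def]] by simp
  moreover from this have "count n j = count m j" if "j < i" for j using that by simp
  ultimately show ?thesis unfolding lexless_def by (meson linorder_neqE_nat)
qed simp

lemma lexless_irrefl: "\<not> lexless m m"
  by (simp add: lexless_def)

lemma lexless_trans: "lexless m n \<Longrightarrow> lexless n k \<Longrightarrow> lexless m k"
proof -
  assume "lexless m n" "lexless n k"
  then obtain i j where i: "\<And>x. x < i \<Longrightarrow> count m x = count n x" "count m i < count n i"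
    and j: "\<And>x. x < j \<Longrightarrow> count n x = count k x" "count n j < count k j"
    unfolding lexless_def by blast
  have "count m x = count k x" if "x < min i j" for x using that i(1)[of x] j(1)[of x] by simp
  moreover have "count m (min i j) < count k (min i j)"
    using i(1)[of j] i(2) j(1)[of i] j(2) by (cases i j rule: linorder_cases) simp_all
  ultimately show "lexless m k" unfolding lexless_def by blast
qed

lemma lexless_add: "lexless m n \<Longrightarrow> lexless (m + k) (n + k)"
  by (simp add: lexless_def)

text \<open>The leading coefficient has to be a sign so that it can be cancelled over every
  coefficient ring.\<close>

definition leading :: "symfun \<Rightarrow> nat multiset \<Rightarrow> bool" where
  "leading f m \<longleftrightarrow> symfun_coeff f m \<in> {1, - 1} \<and> (\<forall>n. lexless m n \<longrightarrow> symfun_coeff f n = 0)"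

text \<open>Multiplication respects the order. So monomials not above \<open>m\<close> and
  \<open>n\<close> have the product \<open>m + n\<close> only if they are \<open>m\<close> and
  \<open>n\<close> themselves, and never a larger one.\<close>

lemma leading_mult:
  assumes f: "leading f m" and g: "leading g n"
  shows "leading (f * g) (m + n)"
proof -
  have zero: "symfun_coeff f k * symfun_coeff g l = 0"
    if "lexless (m + n) (k + l) \<or> k + l = m + n \<and> (k, l) \<noteq> (m, n)" for k l
  proof (rule ccontr)
    assume "symfun_coeff f k * symfun_coeff g l \<noteq> 0"
    then have "\<not> lexless m k" "\<not> lexless n l" using f g by (auto simp: leading_def)
    then have "k = m \<or> lexless k m" "l = n \<or> lexless l n" using lexless_linear by blast+
    then consider "k = m" "l = n" | "k = m" "lexless l n" | "lexless k m" "l = n"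
      | "lexless k m" "lexless l n" by blast
    then have "(k, l) = (m, n) \<or> lexless (k + l) (m + n)"
    proof cases
      case 2
      then show ?thesis using lexless_add[of l n m] by (simp add: add.commute)
    next
      case 3
      then show ?thesis using lexless_add[of k m n] by simp
    next
      case 4
      then have "lexless (k + l) (m + l)" "lexless (m + l) (m + n)"
        using lexless_add[of k m l] lexless_add[of l n m] by (simp_all add: add.commute)
      then show ?thesis using lexless_trans by blast
    qed simp
    then show False
    proof
      assume "(k, l) = (m, n)"
      then show False using that lexless_irrefl by simp
    next
      assume less: "lexless (k + l) (m + n)"
      then have "lexless (m + n) (k + l)" using that lexless_irrefl[of "m + n"] by auto
      then have "lexless (m + n) (m + n)" using less by (rule lexless_trans)
      then show False using lexless_irrefl by simp
    qed
  qed
  have "symfun_coeff (f * g) (m + n)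
      = (\<Sum>(k, l) \<in> {(m, n)}. symfun_coeff f k * symfun_coeff g l)"
    unfolding coeff_mult
  proof (rule sum.mono_neutral_right[OF finite_mset_sums])
    show "\<forall>z\<in>{(k, l). k + l = m + n} - {(m, n)}. (case z of (k, l) \<Rightarrow> symfun_coeff f k * symfun_coeff g l) = 0"
    proof
      fix z assume z: "z \<in> {(k, l). k + l = m + n} - {(m, n)}"
      obtain k l where kl: "z = (k, l)" by force
      with z have "k + l = m + n \<and> (k, l) \<noteq> (m, n)" by blast
      then show "(case z of (k, l) \<Rightarrow> symfun_coeff f k * symfun_coeff g l) = 0"
        unfolding kl prod.case by (intro zero disjI2)
    qed
  qed simp
  moreover have "symfun_coeff (f * g) k = 0" if "lexless (m + n) k" for k
    unfolding coeff_mult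
  proof (rule sum.neutral, rule ballI)
    fix z assume z: "z \<in> {(u, v). u + v = k}"
    obtain u v where uv: "z = (u, v)" by force
    with z that have "lexless (m + n) (u + v)" by simp
    then show "(case z of (u, v) \<Rightarrow> symfun_coeff f u * symfun_coeff g v) = 0"
      unfolding uv prod.case by (intro zero disjI1)
  qed
  ultimately show ?thesis using f g by (auto simp: leading_def)
qed

lemma leading_sign: "leading f m \<Longrightarrow> leading ((- 1) ^ k * f) m"
  by (cases "even k") (auto simp: leading_def coeff_uminus)

text \<open>The monomial of the tableau of shape \<open>a\<close> whose row \<open>i\<close> is
  filled with \<open>i\<close>.\<close>

definition pmset :: "partition \<Rightarrow> nat multiset" where
  "pmset a = Abs_multiset (part a)"

lemma count_pmset: "count (pmset a) = part a"
proof -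
  have "finite {i. 0 < part a i}" using part[of a] by simp
  then show ?thesis by (simp add: pmset_def count_Abs_multiset)
qed

lemma count_image_mset_Suc: "count (image_mset Suc m) (Suc i) = count m i"
  by (induction m) auto

lemma pmset_tail: "pmset a = replicate_mset (part a 0) 0 + image_mset Suc (pmset (tail_part a))"
proof (rule multiset_eqI)
  fix i
  have "count (image_mset Suc (pmset (tail_part a))) 0 = 0" by (simp add: not_in_iff[symmetric])
  then show "count (pmset a) i
      = count (replicate_mset (part a 0) 0 + image_mset Suc (pmset (tail_part a))) i"
    by (cases i) (simp_all add: count_pmset part_tail count_image_mset_Suc)
qed

text \<open>Extracting the variable 0 removes a horizontal strip of size \<open>k\<close>. For
  \<open>k = part a 0\<close> this must leave the tail, and larger strips do not exist.\<close>

lemma coeff_schur_step: "symfun_coeff (schur a) (replicate_mset k 0 + image_mset Suc m)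
    = (if k = part a 0 then symfun_coeff (schur (tail_part a)) m
       else if part a 0 < k then 0 else symfun_coeff (skew_h k (schur a)) m)"
  using skew_h_schur_top[of a] skew_h_schur_eq_0[of a k] by (simp flip: coeff_skew_h)

lemma coeff_schur_pmset: "symfun_coeff (schur a) (pmset a) = 1"
proof (induction "plen a" arbitrary: a)
  case 0
  then have a: "part a = (\<lambda>_. 0)" using part_eq_0_iff[of a] by (auto simp: fun_eq_iff)
  then have "diagram (part a) = {}" by (simp add: diagram_def)
  then have "{T \<in> ssyt (part a). tableau_content (part a) T = {#}} = {\<lambda>_. undefined}"
    by (auto simp: ssyt_def tableau_content_def)
  moreover have "pmset a = {#}" by (rule multiset_eqI) (simp add: count_pmset a)
  ultimately show ?case by (simp add: schur.rep_eq schur_series_def)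
next
  case (Suc n)
  have "n = plen (tail_part a)" using Suc.hyps(2) plen_tail[of a] by linarith
  then have "symfun_coeff (schur (tail_part a)) (pmset (tail_part a)) = 1" by (rule Suc.hyps)
  then show ?case by (subst pmset_tail) (simp add: coeff_schur_step)
qed

text \<open>A monomial above \<open>pmset a\<close> first differs from it at an index
  \<open>i\<close> where its exponent is too large. The equal exponents before \<open>i\<close>
  strip off whole rows; then the next row is too short for a horizontal strip of the required
  size.\<close>

lemma leading_schur: "leading (schur a) (pmset a)"
proof -
  have "symfun_coeff (schur a) m = 0"
    if "\<forall>j<i. part a j = count m j" "part a i < count m i" for i m
    using that
  proof (induction i arbitrary: a m)
    case 0
    obtain k n where m: "m = replicate_mset k 0 + image_mset Suc n" by (rule mset_zero_Suc_cases)
    have "count (image_mset Suc n) 0 = 0" by (simp add: not_in_iff[symmetric])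
    with 0 m have "part a 0 < k" by simp
    then show ?case unfolding m coeff_schur_step by simp
  next
    case (Suc i)
    obtain k n where m: "m = replicate_mset k 0 + image_mset Suc n" by (rule mset_zero_Suc_cases)
    have 0: "count (image_mset Suc n) 0 = 0" by (simp add: not_in_iff[symmetric])
    have S: "count m (Suc j) = count n j" for j by (simp add: m count_image_mset_Suc)
    have "part a 0 = count m 0" using Suc.prems by simp
    with m 0 have k: "k = part a 0" by simp
    have "\<forall>j<i. part (tail_part a) j = count n j"
      using Suc.prems(1) S by (auto simp: part_tail)
    moreover have "part (tail_part a) i < count n i" using Suc.prems(2) S by (simp add: part_tail)
    ultimately have "symfun_coeff (schur (tail_part a)) n = 0" by (rule Suc.IH)
    then show ?case unfolding m coeff_schur_step by (simp add: k)
  qed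
  then show ?thesis by (auto simp: leading_def coeff_schur_pmset lexless_def count_pmset)
qed


section \<open>Relations over an arbitrary ring\<close>

text \<open>The action of the integers on an arbitrary abelian group; \<open>of_int\<close> would
  demand \<open>0 \<noteq> 1\<close> in the coefficient ring.\<close>

definition zscale :: "int \<Rightarrow> 'a::ab_group_add \<Rightarrow> 'a" where
  "zscale n x = (\<Sum>i<nat n. x) - (\<Sum>i<nat (- n). x)"

lemma sum_const_add: "(\<Sum>i<k + l :: nat. x :: 'a::ab_group_add) = (\<Sum>i<k. x) + (\<Sum>i<l. x)"
  by (induction l) (simp_all add: algebra_simps)

text \<open>Any representation as a difference of naturals may be used, which reduces additivity in
  the scalar to adding representations.\<close>

lemma zscale_diff_nat: "zscale (int k - int l) x = (\<Sum>i<k. x) - (\<Sum>i<l. x)"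
proof (cases "l \<le> k")
  case True
  then obtain d where "k = l + d" using le_Suc_ex by blast
  then show ?thesis by (simp add: zscale_def sum_const_add)
next
  case False
  then obtain d where "l = k + d" using le_Suc_ex nat_le_linear by blast
  then show ?thesis by (simp add: zscale_def sum_const_add)
qed

lemma zscale_add_left: "zscale (m + n) x = zscale m x + zscale n x"
proof -
  obtain k l k' l' where "m = int k - int l" "n = int k' - int l'" by (metis int_diff_cases)
  moreover from this have "m + n = int (k + k') - int (l + l')" by simp
  ultimately show ?thesis by (simp only: zscale_diff_nat sum_const_add) simp
qed

lemma zscale_add_right: "zscale n (x + y) = zscale n x + zscale n y"
  by (simp add: zscale_def sum.distrib)

lemma zscale_0_left [simp]: "zscale 0 x = 0"
  by (simp add: zscale_def)

lemma zscale_0_right [simp]: "zscale n 0 = 0"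
  by (simp add: zscale_def)

lemma zscale_1 [simp]: "zscale 1 x = x"
  by (simp add: zscale_def)

lemma zscale_minus_left: "zscale (- n) x = - zscale n x"
  by (simp add: zscale_def)

lemma zscale_diff_left: "zscale (m - n) x = zscale m x - zscale n x"
  using zscale_add_left[of m "- n" x] by (simp add: zscale_minus_left)

lemma zscale_sum_right: "zscale n (sum f A) = (\<Sum>x\<in>A. zscale n (f x))"
  by (induction A rule: infinite_finite_induct) (simp_all add: zscale_add_right)

text \<open>The homomorphism on the free abelian group that extends \<open>g\<close>.\<close>

definition frag_eval :: "('p \<Rightarrow> 'a::ab_group_add) \<Rightarrow> ('p \<Rightarrow>\<^sub>0 int) \<Rightarrow> 'a" where
  "frag_eval g x = (\<Sum>p\<in>Poly_Mapping.keys x. zscale (Poly_Mapping.lookup x p) (g p))"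

lemma frag_eval_superset:
  assumes "finite A" "Poly_Mapping.keys x \<subseteq> A"
  shows "frag_eval g x = (\<Sum>p\<in>A. zscale (Poly_Mapping.lookup x p) (g p))"
  unfolding frag_eval_def using assms
  by (intro sum.mono_neutral_left) (auto simp: in_keys_iff)

lemma frag_eval_diff: "frag_eval g (x - y) = frag_eval g x - frag_eval g y"
proof -
  let ?A = "Poly_Mapping.keys x \<union> Poly_Mapping.keys y"
  have "finite ?A" "Poly_Mapping.keys (x - y) \<subseteq> ?A" by (auto simp: in_keys_iff lookup_minus)
  then show ?thesis
    using frag_eval_superset[of ?A "x - y" g] frag_eval_superset[of ?A x g] frag_eval_superset[of ?A y g]
    by (simp add: lookup_minus zscale_diff_left sum_subtractf)
qed

lemma frag_eval_0 [simp]: "frag_eval g 0 = 0"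
  by (simp add: frag_eval_def)

lemma frag_eval_add: "frag_eval g (x + y) = frag_eval g x + frag_eval g y"
  using frag_eval_diff[of g x "- y"] frag_eval_diff[of g 0 y] by simp

lemma frag_eval_sum: "frag_eval g (sum f A) = (\<Sum>i\<in>A. frag_eval g (f i))"
  by (induction A rule: infinite_finite_induct) (simp_all add: frag_eval_add)

lemma frag_eval_of [simp]: "frag_eval g (frag_of p) = g p"
  by (simp add: frag_eval_def)

definition additive_map :: "('a::ab_group_add \<Rightarrow> 'b::ab_group_add) \<Rightarrow> bool" where
  "additive_map h \<longleftrightarrow> (\<forall>x y. h (x + y) = h x + h y)"

lemma additive_map_zero: "additive_map h \<Longrightarrow> h 0 = 0"
  unfolding additive_map_def by (metis add_cancel_right_right)

text \<open>Sending \<open>(r, f)\<close> to the multiple of \<open>r\<close> by \<open>h f\<close>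
  is biadditive, hence it kills the defining relations of the tensor product. Such evaluations take
  the place of a basis of the symmetric functions.\<close>

lemma tensor_null_eval:
  assumes "additive_map h" "tensor_null x"
  shows "frag_eval (\<lambda>(r, f). zscale (h f) r) x = 0"
  using assms(2)
proof induction
  case (left a a' b)
  show ?case by (simp add: frag_eval_diff zscale_add_right)
next
  case (right a b b')
  show ?case using assms(1) by (simp add: frag_eval_diff additive_map_def zscale_add_left)
qed (simp_all add: frag_eval_diff)

text \<open>
  A relation \<open>\<Sum>i\<in>J. c i \<otimes> F i = 0\<close>, seen through the maps induced by the integer-valued additive functionals.
\<close>

definition relation :: "'i set \<Rightarrow> ('i \<Rightarrow> 'r::ab_group_add) \<Rightarrow> ('i \<Rightarrow> 'm::ab_group_add) \<Rightarrow> bool" where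
  "relation J c F \<longleftrightarrow> (\<forall>h. additive_map h \<longrightarrow> (\<Sum>i\<in>J. zscale (h (F i)) (c i)) = 0)"

lemma relation_tensor:
  fixes c :: "'i \<Rightarrow> 'r::{comm_ring, comm_monoid_mult}" and F :: "'i \<Rightarrow> 'm::{comm_ring, comm_monoid_mult}"
  assumes "(\<Sum>i\<in>J. c i \<otimes>\<^sub>\<int> F i) = 0"
  shows "relation J c F"
  unfolding relation_def
proof (intro allI impI)
  fix h :: "'m \<Rightarrow> int" assume h: "additive_map h"
  have "(\<Sum>i\<in>J. c i \<otimes>\<^sub>\<int> F i) = abs_tensor (\<Sum>i\<in>J. frag_of (c i, F i))"
    by (induction J rule: infinite_finite_induct)
      (simp_all add: pure_tensor.abs_eq plus_tensor.abs_eq zero_tensor_def)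
  with assms have "abs_tensor (\<Sum>i\<in>J. frag_of (c i, F i)) = (abs_tensor 0 :: ('r, 'm) tensor)"
    by (simp add: zero_tensor_def)
  then have "tensor_null (\<Sum>i\<in>J. frag_of (c i, F i))"
    by (simp add: tensor.abs_eq_iff tensor_rel_def)
  from tensor_null_eval[OF h this] show "(\<Sum>i\<in>J. zscale (h (F i)) (c i)) = 0"
    by (simp add: frag_eval_sum)
qed

text \<open>Precomposing the functionals with \<open>g\<close> replaces the base change of
  \<open>g\<close> to the tensor product.\<close>

lemma relation_map:
  fixes g :: "'m::ab_group_add \<Rightarrow> 'n::ab_group_add"
  assumes "additive_map g" "relation J c F"
  shows "relation J c (\<lambda>i. g (F i))"
  unfolding relation_def
proof (intro allI impI)
  fix h :: "'n \<Rightarrow> int" assume "additive_map h"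
  then have "additive_map (\<lambda>x. h (g x))" using assms(1) by (simp add: additive_map_def)
  then show "(\<Sum>i\<in>J. zscale (h (g (F i))) (c i)) = 0" using assms(2) unfolding relation_def by blast
qed

lemma relation_restrict:
  fixes F :: "'i \<Rightarrow> 'm::ab_group_add"
  assumes "relation J c F" "finite J" "I \<subseteq> J" "\<And>i. i \<in> J - I \<Longrightarrow> c i = 0 \<or> F i = 0"
  shows "relation I c F"
  unfolding relation_def
proof (intro allI impI)
  fix h :: "'m \<Rightarrow> int" assume h: "additive_map h"
  have "(\<Sum>i\<in>I. zscale (h (F i)) (c i)) = (\<Sum>i\<in>J. zscale (h (F i)) (c i))"
    by (rule sum.mono_neutral_left) (use assms(2-4) additive_map_zero[OF h] in force)+
  then show "(\<Sum>i\<in>I. zscale (h (F i)) (c i)) = 0" using assms(1) h by (simp add: relation_def)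
qed

section \<open>Triangularity of leading monomials\<close>

lemma ex_lex_maximal:
  assumes "finite S" "S \<noteq> {}"
  shows "\<exists>i\<in>S. \<forall>j\<in>S. \<not> lexless (e i) (e j)"
  using assms
proof (induction S rule: finite_ne_induct)
  case (singleton i)
  then show ?case by (simp add: lexless_irrefl)
next
  case (insert i S)
  then obtain k where k: "k \<in> S" "\<forall>j\<in>S. \<not> lexless (e k) (e j)" by blast
  show ?case
  proof (cases "lexless (e k) (e i)")
    case True
    then have "\<not> lexless (e i) (e j)" if "j \<in> S" for j using lexless_trans k that by blast
    then show ?thesis using lexless_irrefl by blast
  next
    case False
    then show ?thesis using k by blast
  qed
qed

text \<open>Among the indices with nonzero coefficient take one with maximal leading monomial. The
  coefficient functional at this monomial sees no other term of the relation, and its value there is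
  a sign.\<close>

lemma relation_leading:
  assumes rel: "relation J c F" and fin: "finite J"
    and lead: "\<And>i. i \<in> J \<Longrightarrow> leading (F i) (e i)" and inj: "inj_on e J" and i: "i \<in> J"
  shows "c i = 0"
proof (rule ccontr)
  let ?S = "{i \<in> J. c i \<noteq> 0}"
  assume "c i \<noteq> 0"
  then have "?S \<noteq> {}" using i by blast
  then obtain k where k: "k \<in> ?S" "\<forall>j\<in>?S. \<not> lexless (e k) (e j)"
    using ex_lex_maximal[of ?S e] fin by auto
  have 0: "zscale (symfun_coeff (F j) (e k)) (c j) = 0" if "j \<in> J - {k}" for j
  proof (cases "c j = 0")
    case False
    then have "\<not> lexless (e k) (e j)" "e j \<noteq> e k" using k that inj by (auto simp: inj_on_def)
    then have "lexless (e j) (e k)" using lexless_linear by blast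
    then show ?thesis using lead[of j] that by (simp add: leading_def)
  qed simp
  have "additive_map (\<lambda>f. symfun_coeff f (e k))" by (simp add: additive_map_def coeff_add)
  then have "(\<Sum>j\<in>J. zscale (symfun_coeff (F j) (e k)) (c j)) = 0" 
    by (rule rel[unfolded relation_def, rule_format])
  then have "zscale (symfun_coeff (F k) (e k)) (c k) = 0"
    using fin k 0 by (simp add: sum.remove[of J k])
  then show False using k lead[of k] by (auto simp: leading_def zscale_minus_left)
qed


section \<open>Products with a fixed sum of shapes\<close>

text \<open>In the sum of \<open>skew_h_mult\<close>, every index but \<open>part a 0\<close> asks
  one of the factors for a strip longer than its first row.\<close>

lemma skew_h_schur_mult_top:
  "skew_h (part a 0 + part b 0) (schur a * schur b) = schur (tail_part a) * schur (tail_part b)"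
proof -
  have "skew_h (part a 0 + part b 0) (schur a * schur b)
      = (\<Sum>i\<in>{part a 0}. skew_h i (schur a) * skew_h (part a 0 + part b 0 - i) (schur b))"
    unfolding skew_h_mult
  proof (rule sum.mono_neutral_right)
    show "\<forall>i\<in>{..part a 0 + part b 0} - {part a 0}.
        skew_h i (schur a) * skew_h (part a 0 + part b 0 - i) (schur b) = 0"
    proof
      fix i assume "i \<in> {..part a 0 + part b 0} - {part a 0}"
      then consider "part a 0 < i" | "part b 0 < part a 0 + part b 0 - i" by force
      then show "skew_h i (schur a) * skew_h (part a 0 + part b 0 - i) (schur b) = 0"
        by cases (simp_all add: skew_h_schur_eq_0)
    qed
  qed auto
  then show ?thesis by (simp add: skew_h_schur_top)
qed

lemma skew_h_schur_mult_eq_0: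
  assumes "part a 0 + part b 0 < d"
  shows "skew_h d (schur a * schur b) = 0"
  unfolding skew_h_mult
proof (rule sum.neutral, rule ballI)
  fix i
  consider "part a 0 < i" | "part b 0 < d - i" using assms by linarith
  then show "skew_h i (schur a) * skew_h (d - i) (schur b) = 0"
    by cases (simp_all add: skew_h_schur_eq_0)
qed

text \<open>Each round keeps only the products with the largest sum of first rows. The coefficients
  stay unchanged, so for a family with nonzero coefficients a contradiction arises once a single
  coefficient of the nonempty rest \<open>S'\<close> is shown to vanish.\<close>

lemma relation_strip_rows:
  assumes "finite S" "S \<noteq> {}" "relation S c (\<lambda>P. schur (x P) * schur (y P))"
  shows "\<exists>S' s. S' \<subseteq> S \<and> S' \<noteq> {} \<and>
    relation S' c (\<lambda>P. schur ((tail_part ^^ k) (x P)) * schur ((tail_part ^^ k) (y P))) \<and>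
    (\<forall>P\<in>S'. \<forall>i<k. part (x P) i + part (y P) i = s i)"
  using assms
proof (induction k arbitrary: x y S)
  case 0
  then show ?case by (intro exI[of _ S]) simp
next
  case (Suc k)
  define f where "f P = part (x P) 0 + part (y P) 0" for P
  define d where "d = Max (f ` S)"
  define S1 where "S1 = {P \<in> S. f P = d}"
  have fd: "f P \<le> d" if "P \<in> S" for P unfolding d_def using Suc.prems(1) that by simp
  have "d \<in> f ` S" unfolding d_def using Suc.prems(1,2) by (intro Max_in) auto
  then have S1: "finite S1" "S1 \<noteq> {}" "S1 \<subseteq> S" using Suc.prems(1) by (auto simp: S1_def)
  have "relation S c (\<lambda>P. skew_h d (schur (x P) * schur (y P)))"
    by (rule relation_map[OF _ Suc.prems(3)]) (simp add: additive_map_def skew_h_add)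
  then have "relation S1 c (\<lambda>P. skew_h d (schur (x P) * schur (y P)))"
  proof (rule relation_restrict[OF _ Suc.prems(1) S1(3)])
    fix P assume "P \<in> S - S1"
    then have "f P < d" using fd[of P] by (auto simp: S1_def)
    then show "c P = 0 \<or> skew_h d (schur (x P) * schur (y P)) = 0"
      by (simp add: f_def skew_h_schur_mult_eq_0)
  qed
  moreover have "skew_h d (schur (x P) * schur (y P)) = schur (tail_part (x P)) * schur (tail_part (y P))"
    if "P \<in> S1" for P
    using that skew_h_schur_mult_top[of "x P" "y P"] by (simp add: S1_def f_def)
  ultimately have "relation S1 c (\<lambda>P. schur (tail_part (x P)) * schur (tail_part (y P)))"
    by (simp add: relation_def cong: sum.cong)
  from Suc.IH[OF S1(1,2) this] obtain S' s where S': "S' \<subseteq> S1" "S' \<noteq> {}"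
    "relation S' c (\<lambda>P. schur ((tail_part ^^ k) (tail_part (x P))) * schur ((tail_part ^^ k) (tail_part (y P))))"
    "\<forall>P\<in>S'. \<forall>i<k. part (tail_part (x P)) i + part (tail_part (y P)) i = s i"
    by (elim exE conjE) (rule that)
  \<comment> \<open>The maximal sum \<open>d\<close> of first rows is put in front of the row sums
    of the tails.\<close>
  have sum: "part (x P) i + part (y P) i = case_nat d s i" if "P \<in> S'" "i < Suc k" for P i
  proof (cases i)
    case 0
    then show ?thesis using that S'(1) by (auto simp: S1_def f_def)
  next
    case (Suc j)
    then have "part (tail_part (x P)) j + part (tail_part (y P)) j = s j" using that S'(4) by blast
    then show ?thesis by (simp add: part_tail Suc)
  qed
  have "(tail_part ^^ k) (tail_part z) = (tail_part ^^ Suc k) z" for z by (simp only: funpow_Suc_right comp_apply)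
  with S'(3) have "relation S' c (\<lambda>P. schur ((tail_part ^^ Suc k) (x P)) * schur ((tail_part ^^ Suc k) (y P)))"
    by (simp only:)
  moreover have "S' \<subseteq> S" using S'(1) S1(3) by (rule subset_trans)
  ultimately show ?case using S'(2) sum by (intro exI[of _ S'] exI[of _ "case_nat d s"]) simp
qed

lemma hook_eq_0_iff: "hook a = 0 \<longleftrightarrow> (\<forall>i. part a i = 0)"
proof
  assume "hook a = 0"
  then have "part a 0 = 0" using part_eq_0_iff[of a 0] by (auto simp: hook_def)
  then show "\<forall>i. part a i = 0" using part_antimono[of 0 _ a] by fastforce
next
  assume "\<forall>i. part a i = 0"
  then show "hook a = 0" using part_eq_0_iff[of a 0] by (simp add: hook_def)
qed

text \<open>Once row \<open>Suc i\<close> is known, so is row \<open>i\<close> of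
  \<open>inner_part\<close>, and the equation yields \<open>s i - part a i\<close>; the bound by
  \<open>s i\<close> makes this determine \<open>part a i\<close>.\<close>

lemma partition_from_inner:
  assumes "\<And>i. part a i \<le> s i" "\<And>i. part b i \<le> s i"
    and eq: "\<And>i. part (inner_part a) i + (s i - part a i) = part (inner_part b) i + (s i - part b i)"
  shows "a = b"
proof (rule part_eqI)
  fix i
  obtain N where N: "\<And>i. N \<le> i \<Longrightarrow> part a i = 0" using part_eventually_zero[of a] by blast
  obtain M where M: "\<And>i. M \<le> i \<Longrightarrow> part b i = 0" using part_eventually_zero[of b] by blast
  \<comment> \<open>Row \<open>N + M + i\<close> is empty in both partitions and starts the
    descending induction.\<close>
  have "i \<le> N + M + i" by simp
  then show "part a i = part b i"
  proof (induction rule: inc_induct)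
    case base
    show ?case using N[of "N + M + i"] M[of "N + M + i"] by simp
  next
    case (step i)
    have "part a (Suc i) \<le> part a i" "part b (Suc i) \<le> part b i" by (simp_all add: part_antimono)
    with step.IH eq[of i] assms(1,2)[of i] show ?case by (simp add: part_inner)
  qed
qed

text \<open>The Leibniz rule splits each product into two terms, one for each of its shapes, so the
  relation is rewritten as one indexed by shapes instead of pairs. By \<open>distinct\<close>
  together with \<open>sum\<close>, no shape belongs to two pairs.\<close>

lemma relation_fixed_sum:
  assumes fin: "finite S" and rel: "relation S c (\<lambda>P. schur (x P) * schur (y P))"
    and sum: "\<And>P i. P \<in> S \<Longrightarrow> part (x P) i + part (y P) i = s i"
    and distinct: "\<And>P Q. P \<in> S \<Longrightarrow> Q \<in> S \<Longrightarrow> x P = x Q \<or> x P = y Q \<Longrightarrow> P = Q"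
    and P: "P \<in> S"
  shows "c P = 0"
proof -
  define A where "A = x ` S \<union> y ` S"
  \<comment> \<open>The common sum \<open>s\<close> makes the partner of a shape a function of the
    shape alone.\<close>
  define co where "co a = Abs_partition (\<lambda>i. s i - part a i)" for a
  \<comment> \<open>Both summands are kept, so a pair with \<open>x P = y P\<close> contributes
    twice its coefficient.\<close>
  define c' where "c' a = (\<Sum>P\<in>S. (if x P = a then c P else 0) + (if y P = a then c P else 0))" for a
  define G where "G m a = skew_p m (schur a) * schur (co a)" for m a
  have finA: "finite A" using fin by (simp add: A_def)
  have co: "co (x P) = y P" "co (y P) = x P" if "P \<in> S" for P
  proof -
    have "(\<lambda>i. s i - part (x P) i) = part (y P)" "(\<lambda>i. s i - part (y P) i) = part (x P)"
      using sum[OF that] by (auto simp: fun_eq_iff simp flip: sum[OF that])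
    then show "co (x P) = y P" "co (y P) = x P" by (simp_all add: co_def part_inverse)
  qed
  have A: "part a i \<le> s i" "part (co a) i = s i - part a i" if a: "a \<in> A" for a i
  proof -
    consider P where "P \<in> S" "a = x P" | P where "P \<in> S" "a = y P"
      using a by (auto simp: A_def)
    then show "part a i \<le> s i" "part (co a) i = s i - part a i"
      by (cases; use co sum[of _ i] in \<open>simp flip: sum[of _ i]\<close>)+
  qed
  have relG: "relation A c' (G m)" for m
    unfolding relation_def
  proof (intro allI impI)
    fix h :: "symfun \<Rightarrow> int" assume h: "additive_map h"
    have "relation S c (\<lambda>P. skew_p m (schur (x P) * schur (y P)))"
      by (rule relation_map[OF _ rel]) (simp add: additive_map_def skew_p_add)
    then have "0 = (\<Sum>P\<in>S. zscale (h (skew_p m (schur (x P) * schur (y P)))) (c P))"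
      using h by (simp add: relation_def)
    also have "\<dots> = (\<Sum>P\<in>S. zscale (h (G m (x P))) (c P) + zscale (h (G m (y P))) (c P))"
    proof (rule sum.cong)
      fix P assume "P \<in> S"
      then show "zscale (h (skew_p m (schur (x P) * schur (y P)))) (c P)
          = zscale (h (G m (x P))) (c P) + zscale (h (G m (y P))) (c P)"
        using h by (simp add: G_def co skew_p_mult additive_map_def mult.commute flip: zscale_add_left)
    qed simp
    also have "\<dots> = (\<Sum>P\<in>S. \<Sum>a\<in>A. zscale (h (G m a)) ((if x P = a then c P else 0) + (if y P = a then c P else 0)))"
    proof (rule sum.cong)
      fix P assume "P \<in> S"
      then have "x P \<in> A" "y P \<in> A" by (auto simp: A_def)
      moreover have "zscale n (if Q then u else 0) = (if Q then zscale n u else 0)" for n Q and u :: 'b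
        by simp
      ultimately show "zscale (h (G m (x P))) (c P) + zscale (h (G m (y P))) (c P)
          = (\<Sum>a\<in>A. zscale (h (G m a)) ((if x P = a then c P else 0) + (if y P = a then c P else 0)))"
        using finA by (simp add: zscale_add_right sum.distrib)
    qed simp
    also have "\<dots> = (\<Sum>a\<in>A. zscale (h (G m a)) (c' a))"
      unfolding c'_def zscale_sum_right by (rule sum.swap)
    finally show "(\<Sum>a\<in>A. zscale (h (G m a)) (c' a)) = 0" by simp
  qed
  \<comment> \<open>Let \<open>m\<close> be the largest hook length with a nonzero coefficient. Then
    \<open>skew_p m\<close> kills the shapes with smaller hooks, those with larger hooks have
    coefficient 0, and the remaining terms have distinct leading monomials.\<close>
  have c'0: "c' a = 0" if "a \<in> A" "0 < hook a" for a
  proof (rule ccontr)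
    let ?B = "{a \<in> A. 0 < hook a \<and> c' a \<noteq> 0}"
    assume "c' a \<noteq> 0"
    then have B: "finite ?B" "?B \<noteq> {}" using that finA by auto
    define m where "m = Max (hook ` ?B)"
    define C where "C = {a \<in> ?B. hook a = m}"
    have "m \<in> hook ` ?B" unfolding m_def using B by (intro Max_in) auto
    then obtain b where b: "b \<in> C" by (auto simp: C_def)
    then have m0: "0 < m" by (auto simp: C_def)
    have hm: "hook a \<le> m" if "a \<in> ?B" for a unfolding m_def using B that by (intro Max_ge) auto
    have "relation C c' (G m)"
    proof (rule relation_restrict[OF relG finA])
      fix a assume a: "a \<in> A - C"
      show "c' a = 0 \<or> G m a = 0"
      proof (cases "hook a < m")
        case True
        then show ?thesis by (simp add: G_def skew_p_schur_eq_0[OF m0])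
      next
        case False
        then show ?thesis using a hm[of a] m0 by (auto simp: C_def)
      qed
    qed (auto simp: C_def)
    then have "c' b = 0"
    proof (rule relation_leading[OF _ _ _ _ b])
      show "finite C" using finA by (rule finite_subset[rotated]) (auto simp: C_def)
      show "leading (G m a) (pmset (inner_part a) + pmset (co a))" if "a \<in> C" for a
        unfolding G_def using that skew_p_schur_hook[of a] m0
        by (auto simp: C_def intro!: leading_mult leading_sign leading_schur)
      show "inj_on (\<lambda>a. pmset (inner_part a) + pmset (co a)) C"
      proof (rule inj_onI)
        fix a a' assume a: "a \<in> C" "a' \<in> C"
          and eq: "pmset (inner_part a) + pmset (co a) = pmset (inner_part a') + pmset (co a')"
        have aA: "a \<in> A" "a' \<in> A" using a by (auto simp: C_def)
        show "a = a'"
        proof (rule partition_from_inner[of a s a'])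
          fix i
          show "part (inner_part a) i + (s i - part a i) = part (inner_part a') i + (s i - part a' i)"
            using arg_cong[OF eq, of "\<lambda>M. count M i"] aA by (simp add: count_pmset A)
        qed (use A aA in auto)
      qed
    qed
    with b show False by (simp add: C_def)
  qed
  have sum_eq': "x P = x Q" if "y P = y Q" "P \<in> S" "Q \<in> S" for P Q
    using co(2)[of P] co(2)[of Q] that by simp
  \<comment> \<open>If the two shapes differ, at least one is nonempty, and by
    \<open>distinct\<close> the coefficient \<open>c'\<close> at that shape collects only
    \<open>c P\<close>.\<close>
  have nonself: "c P = 0" if P: "P \<in> S" and ne: "x P \<noteq> y P" for P
  proof -
    have "0 < hook (x P) \<or> 0 < hook (y P)"
    proof (rule ccontr)
      assume "\<not> ?thesis"
      then have "part (x P) i = part (y P) i" for i using hook_eq_0_iff by simp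
      then have "x P = y P" by (rule part_eqI)
      with ne show False ..
    qed
    then show ?thesis
    proof
      assume "0 < hook (x P)"
      then have "c' (x P) = 0" using P by (intro c'0) (simp_all add: A_def)
      moreover have "c' (x P) = (\<Sum>Q\<in>S. if Q = P then c P else 0)"
        unfolding c'_def
      proof (rule sum.cong)
        fix Q assume Q: "Q \<in> S"
        have "x Q = x P \<longleftrightarrow> Q = P" using distinct[OF Q P] by auto
        moreover have "y Q \<noteq> x P" using distinct[OF P Q] ne by auto
        ultimately show "(if x Q = x P then c Q else 0) + (if y Q = x P then c Q else 0)
            = (if Q = P then c P else 0)" by auto
      qed simp
      ultimately show ?thesis using fin P by simp
    next
      assume "0 < hook (y P)"
      then have "c' (y P) = 0" using P by (intro c'0) (simp_all add: A_def)
      moreover have "c' (y P) = (\<Sum>Q\<in>S. if Q = P then c P else 0)"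
        unfolding c'_def
      proof (rule sum.cong)
        fix Q assume Q: "Q \<in> S"
        have "y Q = y P \<longleftrightarrow> Q = P" using distinct[OF Q P] sum_eq'[of Q P] Q P by auto
        moreover have "x Q \<noteq> y P" using distinct[OF Q P] ne by auto
        ultimately show "(if x Q = y P then c Q else 0) + (if y Q = y P then c Q else 0)
            = (if Q = P then c P else 0)" by auto
      qed simp
      ultimately show ?thesis using fin P by simp
    qed
  qed
  show ?thesis
  proof (cases "x P = y P")
    case True
    \<comment> \<open>Here \<open>c'\<close> would only give \<open>2 c P = 0\<close>. Equal shapes
      are half of \<open>s\<close>, so every other pair is covered by \<open>nonself\<close>, and
      the original relation reduces to a single product.\<close>
    have "relation {P} c (\<lambda>P. schur (x P) * schur (y P))"
    proof (rule relation_restrict[OF rel fin])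
      fix Q assume Q: "Q \<in> S - {P}"
      have "x Q \<noteq> y Q"
      proof
        assume eq: "x Q = y Q"
        have "part (x Q) i = part (x P) i" for i
          using sum[of Q i] sum[OF P, of i] Q eq True by simp
        then have "x Q = x P" by (rule part_eqI)
        then show False using distinct[of Q P] Q P by auto
      qed
      then show "c Q = 0 \<or> schur (x Q) * schur (y Q) = 0" using nonself Q by blast
    qed (use P in simp)
    then show ?thesis
      by (rule relation_leading[where e = "\<lambda>P. pmset (x P) + pmset (y P)"])
        (simp_all add: leading_mult leading_schur)
  qed (use nonself P in blast)
qed


section \<open>Complementary pairs\<close>

lemma part_tail_funpow: "part ((tail_part ^^ k) a) i = part a (i + k)"
  by (induction k arbitrary: i) (simp_all add: part_tail)

lemma part_complement: "part (complement a b l) i = (if i < a then b - part l (a - 1 - i) else 0)"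
  by (simp add: complement.rep_eq)

lemma part_le_rectangle_iff:
  "l \<subseteq>\<^sub>p rectangle a b \<longleftrightarrow> (\<forall>i. part l i \<le> b) \<and> (\<forall>i\<ge>a. part l i = 0)"
proof -
  have "part l i \<le> part (rectangle a b) i \<longleftrightarrow> part l i \<le> b \<and> (a \<le> i \<longrightarrow> part l i = 0)" for i
    by (auto simp: rectangle.rep_eq)
  then show ?thesis unfolding part_le_def by blast
qed

text \<open>For \<open>i < k\<close>, row \<open>i\<close> of \<open>l\<close> is read off from row
  \<open>a - 1 - i\<close> of its complement, and \<open>k + k \<le> a\<close> places that row in
  the retained half.\<close>

lemma partition_from_tails:
  assumes l: "l \<subseteq>\<^sub>p rectangle a b" and m: "m \<subseteq>\<^sub>p rectangle a b" and k: "k + k \<le> a"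
    and tails: "(tail_part ^^ k) l = (tail_part ^^ k) m"
      "(tail_part ^^ k) (complement a b l) = (tail_part ^^ k) (complement a b m)"
  shows "l = m"
proof (rule part_eqI)
  fix i
  show "part l i = part m i"
  proof (cases "k \<le> i")
    case True
    then show ?thesis
      using arg_cong[OF tails(1), of "\<lambda>x. part x (i - k)"] by (simp add: part_tail_funpow)
  next
    case False
    then have j: "a - 1 - i - k + k = a - 1 - i" "a - 1 - i < a" "a - 1 - (a - 1 - i) = i"
      using k by linarith+
    have "part (complement a b l) (a - 1 - i) = part (complement a b m) (a - 1 - i)"
      using arg_cong[OF tails(2), of "\<lambda>x. part x (a - 1 - i - k)"] unfolding part_tail_funpow j(1) .
    then have "b - part l i = b - part m i" by (simp only: part_complement j(2,3) if_True)
    moreover have "part l i \<le> b" "part m i \<le> b" using l m by (simp_all add: part_le_rectangle_iff)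
    ultimately show ?thesis by simp
  qed
qed

text \<open>The row sums at \<open>p\<close> and at \<open>a - 1 - p\<close> add up to
  \<open>2 * b\<close>, so the sums in the upper half fix those in the lower half. For odd
  \<open>a\<close> the middle row has the sum \<open>b\<close>.\<close>

lemma complement_tail_sum:
  assumes l: "l \<subseteq>\<^sub>p rectangle a b" and k: "k = a div 2"
    and s: "\<And>j. j < k \<Longrightarrow> part l j + part (complement a b l) j = s j"
  shows "part l (i + k) + part (complement a b l) (i + k)
    = (if a \<le> i + k then 0 else if a - 1 - (i + k) < k then 2 * b - s (a - 1 - (i + k)) else b)"
proof -
  let ?j = "a - 1 - (i + k)"
  have le: "part l i \<le> b" and zero: "a \<le> i \<Longrightarrow> part l i = 0" for i
    using l by (simp_all add: part_le_rectangle_iff)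
  consider "a \<le> i + k" | "i + k < a" "?j < k" | "i + k < a" "\<not> ?j < k" by linarith
  then show ?thesis
  proof cases
    case 1
    then show ?thesis by (simp add: part_complement zero)
  next
    case 2
    have j: "?j < a" "a - 1 - ?j = i + k" using 2 by linarith+
    have "s ?j = part l ?j + (b - part l (i + k))"
      using s[OF 2(2)] unfolding part_complement j(2) using j(1) by simp
    moreover have "part l (i + k) + part (complement a b l) (i + k) = part l (i + k) + (b - part l ?j)"
      using 2 by (simp add: part_complement)
    ultimately have "part l (i + k) + part (complement a b l) (i + k) = 2 * b - s ?j"
      using le[of ?j] le[of "i + k"] by linarith
    then show ?thesis using 2 by simp
  next
    case 3
    then have "?j = i + k" using k by linarith
    then have "part (complement a b l) (i + k) = b - part l (i + k)"
      using 3 by (simp add: part_complement)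
    then show ?thesis using 3 le[of "i + k"] by simp
  qed
qed

theorem theorem1p1:
  fixes a b :: nat
  assumes "a > 0" and "b > 0"
  shows "linearly_independent_family
    (tensor_scale :: 'r::{comm_ring, comm_monoid_mult} \<Rightarrow> 'r Lambda \<Rightarrow> 'r Lambda)
    (complementary_pairs a b) (pair_product a b)"
  unfolding linearly_independent_family_def
proof (intro allI impI ballI)
  fix J and c :: "partition set \<Rightarrow> 'r" and P0
  assume J: "finite J \<and> J \<subseteq> complementary_pairs a b \<and>
      (\<Sum>P\<in>J. tensor_scale (c P) (pair_product a b P)) = 0" and "P0 \<in> J"
  \<comment> \<open>This is the choice made in \<open>pair_product\<close>, so the products unfold
    directly in terms of \<open>x P\<close> and \<open>y P\<close>.\<close>
  define x where "x P = (SOME l. l \<in> P)" for P :: "partition set"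
  define y where "y P = complement a b (x P)" for P
  have P: "x P \<subseteq>\<^sub>p rectangle a b" "complement a b (y P) = x P" "P = {x P, y P}" if "P \<in> J" for P
  proof -
    have "P \<in> complementary_pairs a b" using that J by blast
    then obtain l where l: "l \<subseteq>\<^sub>p rectangle a b" "P = {l, complement a b l}"
      unfolding complementary_pairs_def by blast
    have "x P \<in> P" unfolding x_def by (rule someI[of _ l]) (simp add: l)
    then have "x P = l \<or> x P = complement a b l" using l by simp
    then have xy: "x P = l \<and> y P = complement a b l \<or> x P = complement a b l \<and> y P = l"
      unfolding y_def using complement_complement[OF l(1)] by (elim disjE) simp_all
    then show rect: "x P \<subseteq>\<^sub>p rectangle a b" using l(1) complement_le[of a b l] by (elim disjE) simp_all
    show "P = {x P, y P}" using xy l(2) by (elim disjE) (simp_all add: insert_commute)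
    show "complement a b (y P) = x P" unfolding y_def by (rule complement_complement[OF rect])
  qed
  have "tensor_scale (c P) (pair_product a b P) = c P \<otimes>\<^sub>\<int> (schur (x P) * schur (y P))" for P
    by (simp add: pair_product_def Let_def schur_in_def pure_tensor_mult tensor_scale_pure x_def y_def)
  with J have "(\<Sum>P\<in>J. c P \<otimes>\<^sub>\<int> (schur (x P) * schur (y P))) = 0" by simp
  then have rel: "relation J c (\<lambda>P. schur (x P) * schur (y P))" by (rule relation_tensor)
  show "c P0 = 0"
  proof (rule ccontr)
    \<comment> \<open>With only nonzero coefficients left, one vanishing coefficient in any
      subfamily is a contradiction.\<close>
    define S where "S = {P \<in> J. c P \<noteq> 0}"
    assume "c P0 \<noteq> 0"
    then have S: "finite S" "S \<noteq> {}" "S \<subseteq> J" using J \<open>P0 \<in> J\<close> by (auto simp: S_def)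
    have relS: "relation S c (\<lambda>P. schur (x P) * schur (y P))"
      by (rule relation_restrict[OF rel _ S(3)]) (use J in \<open>auto simp: S_def\<close>)
    \<comment> \<open>Removing half of the rows is enough for \<open>s\<close> to fix all remaining
      row sums, and it still leaves enough rows to determine the pair.\<close>
    define k where "k = a div 2"
    let ?t = "tail_part ^^ k"
    obtain S' s where S': "S' \<subseteq> S" "S' \<noteq> {}"
      "relation S' c (\<lambda>P. schur (?t (x P)) * schur (?t (y P)))"
      and s: "\<forall>P\<in>S'. \<forall>i<k. part (x P) i + part (y P) i = s i"
      using relation_strip_rows[OF S(1,2) relS, of k] by (elim exE conjE) (rule that)
    define s' where "s' i = (if a \<le> i + k then 0
      else if a - 1 - (i + k) < k then 2 * b - s (a - 1 - (i + k)) else b)" for i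
    have SJ: "P \<in> J" if "P \<in> S'" for P using that S'(1) S(3) by blast
    have sum: "part (?t (x P)) i + part (?t (y P)) i = s' i" if "P \<in> S'" for P i
      unfolding part_tail_funpow s'_def y_def
      by (rule complement_tail_sum[OF P(1)[OF SJ[OF that]] k_def])
        (use s that in \<open>simp add: y_def\<close>)
    obtain Q where Q: "Q \<in> S'" using S'(2) by blast
    have "c Q = 0"
    proof (rule relation_fixed_sum[OF _ S'(3) sum _ Q])
      show "finite S'" using S(1) S'(1) by (rule finite_subset[rotated])
      fix P P' assume PP': "P \<in> S'" "P' \<in> S'" and "?t (x P) = ?t (x P') \<or> ?t (x P) = ?t (y P')"
      note P1 = P[OF SJ[OF PP'(1)]] and P2 = P[OF SJ[OF PP'(2)]]
      have k: "k + k \<le> a" by (simp add: k_def)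
      from \<open>?t (x P) = ?t (x P') \<or> ?t (x P) = ?t (y P')\<close> show "P = P'"
      proof
        assume eq: "?t (x P) = ?t (x P')"
        have "?t (y P) = ?t (y P')"
        proof (rule part_eqI)
          fix i
          show "part (?t (y P)) i = part (?t (y P')) i"
            using sum[OF PP'(1), of i] sum[OF PP'(2), of i] unfolding eq by linarith
        qed
        then have "?t (complement a b (x P)) = ?t (complement a b (x P'))" by (simp only: y_def)
        with eq have "x P = x P'" by (rule partition_from_tails[OF P1(1) P2(1) k])
        then have "{x P, y P} = {x P', y P'}" by (simp only: y_def)
        then show ?thesis by (simp only: P1(3)[symmetric] P2(3)[symmetric])
      next
        \<comment> \<open>In this case \<open>P\<close> turns out to be \<open>P'\<close> with its
          two members exchanged, so \<open>partition_from_tails\<close> is applied to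
          \<open>x P\<close> and \<open>y P'\<close>.\<close>
        assume eq: "?t (x P) = ?t (y P')"
        have "?t (y P) = ?t (x P')"
        proof (rule part_eqI)
          fix i
          show "part (?t (y P)) i = part (?t (x P')) i"
            using sum[OF PP'(1), of i] sum[OF PP'(2), of i] unfolding eq by linarith
        qed
        then have "?t (complement a b (x P)) = ?t (complement a b (y P'))"
          unfolding P2(2) y_def[of P] .
        moreover have "y P' \<subseteq>\<^sub>p rectangle a b" unfolding y_def by (rule complement_le)
        ultimately have xy: "x P = y P'" using eq by (intro partition_from_tails[OF P1(1) _ k])
        then have "y P = x P'" unfolding y_def[of P] by (simp only: P2(2))
        then have "{x P, y P} = {x P', y P'}" using xy by (simp add: insert_commute)
        then show ?thesis by (simp only: P1(3)[symmetric] P2(3)[symmetric])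
      qed
    qed
    then show False using Q S'(1) by (auto simp: S_def)
  qed
qed

end
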